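(* Let $X\subseteq\mathbb{R}^d$ be open, let $w\in C^\infty(X)$, and let $\psi:X\to X$ be smooth and injective with $\det J\psi(x)\neq 0$ for all $x\in X$. Let $\mathscr{G}$ be a sheaf of distributions on $\mathbb{R}^d$ defined by local properties such that $C_{w,\psi}(\mathscr{G}(X))\subseteq\mathscr{G}(X)$, and assume in addition that the following conditions hold. (a) There is an open, relatively compact exhaustion $(X_n)_{n\in\mathbb{N}}$ of $X$ such that for each $n\in\mathbb{N}$, every $x\in X\setminus\overline{X}_n$, and every $\varepsilon>0$ for which $\overline{B(x,\varepsilon)}\subseteq X\setminus X_n$, the restriction map $r_X^{X_n\cup B(x,\varepsilon)}:\mathscr{G}(X)\to\mathscr{G}(X_n\cup B(x,\varepsilon))$ has dense range. (b) There is $\varepsilon_0>0$ such that for all $\varepsilon\in(0,\varepsilon_0)$ there is $\chi_\varepsilon\in\mathscr{D}(B(0,\varepsilon))$ such that for all $x\in X$ with $\overline{B(x,\varepsilon)}\subseteq X$ there is $h\in\mathscr{G}(B(x,\varepsilon))$ satisfying $\langle h,\tau_x\chi_\varepsilon\rangle\neq 0$, where $\tau_x\chi_\varepsilon(y):=\chi_\varepsilon(y-x)$. (c) For every $l\in\mathbb{N}_0$ the set $\{x\in X:\ w(\psi^l(x))\neq 0\}$ is dense in $X$. Then for the weighted composition operator $C_{w,\psi}$ on $\mathscr{G}(X)$ the following are equivalent: (i) $C_{w,\psi}$ is topologizable on $\mathscr{G}(X)$. (ii) $\psi$ has stable orbits.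
   Context: Notation. $\mathbb{N}=\{1,2,\dots\}$, $\mathbb{N}_0=\mathbb{N}\cup\{0\}$. $B(x,\varepsilon)$ is the open Euclidean ball in $\mathbb{R}^d$. $J\psi(x)$ is the Jacobian matrix of $\psi$ at $x$; $\psi^m$ is the $m$-th iterate of $\psi$ ($\psi^0=\mathrm{id}$). $\mathscr{D}(X)$ is the space of compactly supported smooth (complex-valued) functions on $X$ with its standard locally convex (inductive limit) topology, and $\mathscr{D}'(X)$ is the space of distributions on $X$, equipped with the strong dual topology (uniform convergence on bounded subsets of $\mathscr{D}(X)$). Open, relatively compact exhaustion: a sequence $(X_n)_{n\in\mathbb{N}}$ of open subsets of $X$ with $\overline{X}_n$ compact, $\overline{X}_n\subseteq X_{n+1}$ for all $n$, and $\bigcup_n X_n=X$. Sheaf of distributions on $\mathbb{R}^d$ defined by local properties: an assignment $\mathscr{G}$ that associates to each open $X\subseteq\mathbb{R}^d$ a linear subspace $\mathscr{G}(X)\subseteq\mathscr{D}'(X)$, equipped with the subspace topology, such that: for open $Y\subseteq X$ the restriction map $r_X^Y:\mathscr{G}(X)\to\mathscr{G}(Y)$, $u\mapsto u_{|Y}:=u_{|\mathscr{D}(Y)}$ is well defined; and (gluing) for every open $X$, every open cover $(X_\iota)_{\iota\in I}$ of $X$ and all $(u_\iota)\in\prod_{\iota}\mathscr{G}(X_\iota)$ with $u_{\iota|X_\iota\cap X_\kappa}=u_{\kappa|X_\iota\cap X_\kappa}$ for all $\iota,\kappa\in I$ there is $u\in\mathscr{G}(X)$ with $u_{|X_\iota}=u_\iota$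 for all $\iota\in I$. (Localization, i.e. $u,v\in\mathscr{G}(X)$ with $u_{|X_\iota}=v_{|X_\iota}$ for all $\iota$ implies $u=v$, holds automatically.) Weighted composition operator: for $w\in C^\infty(X)$ and smooth $\psi:X\to X$ with $\det J\psi(x)\ne0$ for all $x\in X$, $C_{w,\psi}$ is the unique continuous linear operator on $\mathscr{D}'(X)$ extending $C(X)\ni f\mapsto w\cdot(f\circ\psi)$. For injective $\psi$ it is given by $\langle C_{w,\psi}(u),\varphi\rangle=\langle u,(\varphi\, w/|\det J\psi|)\circ\psi^{-1}\rangle$ for $\varphi\in\mathscr{D}(X)$, where the function on $\psi(X)$ is extended by zero to $X$. If $C_{w,\psi}(\mathscr{G}(X))\subseteq\mathscr{G}(X)$, then $C_{w,\psi}$ is a continuous linear operator on $\mathscr{G}(X)$. Topologizable: a continuous linear operator $T$ on a locally convex space $E$ is topologizable if for every continuous seminorm $p$ on $E$ there is a continuous seminorm $q$ on $E$ such that for all $m\in\mathbb{N}$ there is $\gamma_m>0$ with $p(T^m(x))\le\gamma_m q(x)$ for all $x\in E$. Stable orbits: a continuous map $\psi:X\to X$ has stable orbits if for every compact $K\subseteq X$ there is a compact $L\subseteq X$ with $\psi^m(K)\subseteq L$ for every $m\in\mathbb{N}$. *)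

theory Defs
  imports "HOL-Analysis.Analysis" "HOL-Library.Function_Algebras"
begin

section \<open>Locally convex spaces of complex-valued functions\<close>

text \<open>
  Test functions have type \<open>real^'n \<Rightarrow> complex\<close> and distributions have type
  \<open>(real^'n \<Rightarrow> complex) \<Rightarrow> complex\<close>. The vector spaces below are therefore all subspaces of some
  \<open>'a \<Rightarrow> complex\<close> with pointwise operations. Addition and subtraction are those of
  \<open>Function_Algebras\<close>.
\<close>

definition cscale :: "complex \<Rightarrow> ('a \<Rightarrow> complex) \<Rightarrow> 'a \<Rightarrow> complex" where
  "cscale c f = (\<lambda>x. c * f x)"

global_interpretation cfun: vector_space cscale
  by unfold_locales (auto simp: cscale_def fun_eq_iff algebra_simps)

definition seminorm_on :: "('a \<Rightarrow> complex) set \<Rightarrow> (('a \<Rightarrow> complex) \<Rightarrow> real) \<Rightarrow> bool" where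
  "seminorm_on E p \<longleftrightarrow>
     (\<forall>f\<in>E. 0 \<le> p f) \<and>
     (\<forall>f\<in>E. \<forall>g\<in>E. p (f + g) \<le> p f + p g) \<and>
     (\<forall>c. \<forall>f\<in>E. p (cscale c f) = cmod c * p f)"

text \<open>The locally convex topology on \<open>E\<close> defined by a family \<open>P\<close> of seminorms.\<close>

definition lc_topology ::
  "('a \<Rightarrow> complex) set \<Rightarrow> (('a \<Rightarrow> complex) \<Rightarrow> real) set \<Rightarrow> ('a \<Rightarrow> complex) topology" where
  "lc_topology E P = topology_generated_by
     (insert E {{g \<in> E. p (g - f) < e} | p f e. p \<in> P \<and> f \<in> E \<and> 0 < e})"

lemma topspace_lc_topology [simp]: "topspace (lc_topology E P) = E"
  unfolding lc_topology_def by (subst topology_generated_by_topspace) auto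

definition continuous_seminorm ::
  "('a \<Rightarrow> complex) topology \<Rightarrow> (('a \<Rightarrow> complex) \<Rightarrow> real) \<Rightarrow> bool" where
  "continuous_seminorm T p \<longleftrightarrow>
     seminorm_on (topspace T) p \<and> continuous_map T euclideanreal p"

definition lc_bounded :: "('a \<Rightarrow> complex) topology \<Rightarrow> ('a \<Rightarrow> complex) set \<Rightarrow> bool" where
  "lc_bounded T B \<longleftrightarrow>
     B \<subseteq> topspace T \<and> (\<forall>p. continuous_seminorm T p \<longrightarrow> bdd_above (p ` B))"

definition continuous_linear_operator ::
  "('a \<Rightarrow> complex) topology \<Rightarrow> (('a \<Rightarrow> complex) \<Rightarrow> 'a \<Rightarrow> complex) \<Rightarrow> bool" where
  "continuous_linear_operator T A \<longleftrightarrow>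
     continuous_map T T A \<and>
     (\<forall>f\<in>topspace T. \<forall>g\<in>topspace T. A (f + g) = A f + A g) \<and>
     (\<forall>c. \<forall>f\<in>topspace T. A (cscale c f) = cscale c (A f))"

definition topologizable ::
  "('a \<Rightarrow> complex) topology \<Rightarrow> (('a \<Rightarrow> complex) \<Rightarrow> 'a \<Rightarrow> complex) \<Rightarrow> bool" where
  "topologizable T A \<longleftrightarrow>
     continuous_linear_operator T A \<and>
     (\<forall>p. continuous_seminorm T p \<longrightarrow>
        (\<exists>q. continuous_seminorm T q \<and>
           (\<forall>m\<ge>1. \<exists>\<gamma>>0. \<forall>f\<in>topspace T. p ((A ^^ m) f) \<le> \<gamma> * q f)))"


section \<open>Smooth functions and test functions\<close>

definition partial_deriv ::
  "'n \<Rightarrow> (real^'n \<Rightarrow> 'b::real_normed_vector) \<Rightarrow> real^'n \<Rightarrow> 'b" where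
  "partial_deriv i f = (\<lambda>x. frechet_derivative f (at x) (axis i 1))"

text \<open>
  The list \<open>[i\<^sub>1, \<dots>, i\<^sub>k]\<close> stands for the iterated derivative
  \<open>\<partial>\<^bsub>i\<^sub>1\<^esub> \<dots> \<partial>\<^bsub>i\<^sub>k\<^esub>\<close>; every multi-index is represented by such a list.
\<close>

definition partial_derivs ::
  "'n list \<Rightarrow> (real^'n \<Rightarrow> 'b::real_normed_vector) \<Rightarrow> real^'n \<Rightarrow> 'b" where
  "partial_derivs is f = foldr partial_deriv is f"

text \<open>
  Meant for open \<open>S\<close> only. Differentiability of all iterated partial derivatives entails their
  continuity, so on open sets this is \<open>C\<^sup>\<infinity>\<close>.
\<close>

definition smooth_on :: "(real^'n) set \<Rightarrow> (real^'n \<Rightarrow> 'b::real_normed_vector) \<Rightarrow> bool" where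
  "smooth_on S f \<longleftrightarrow> (\<forall>is. \<forall>x\<in>S. partial_derivs is f differentiable (at x))"

definition supp :: "(real^'n \<Rightarrow> complex) \<Rightarrow> (real^'n) set" where
  "supp \<phi> = closure {x. \<phi> x \<noteq> 0}"

text \<open>
  A test function on an open set \<open>X\<close> is identified with its extension by zero to the whole space,
  so that \<open>test_funs Y \<subseteq> test_funs X\<close> whenever \<open>Y \<subseteq> X\<close>.
\<close>

definition test_funs :: "(real^'n) set \<Rightarrow> (real^'n \<Rightarrow> complex) set" where
  "test_funs X = {\<phi>. smooth_on UNIV \<phi> \<and> compact (supp \<phi>) \<and> supp \<phi> \<subseteq> X}"

text \<open>The Frechet space of smooth functions supported in a fixed compact set \<open>K\<close>.\<close>

definition test_funs_in_topology :: "(real^'n) set \<Rightarrow> (real^'n \<Rightarrow> complex) topology" where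
  "test_funs_in_topology K =
     lc_topology {\<phi>. smooth_on UNIV \<phi> \<and> supp \<phi> \<subseteq> K}
       {(\<lambda>\<phi>. SUP x. cmod (partial_derivs is \<phi> x)) | is. True}"

text \<open>
  The locally convex inductive limit topology: the finest locally convex topology for which the
  inclusions of all the above spaces with \<open>K \<subseteq> X\<close> compact are continuous. It is defined by all
  seminorms whose restrictions to these spaces are continuous.
\<close>

definition test_topology :: "(real^'n) set \<Rightarrow> (real^'n \<Rightarrow> complex) topology" where
  "test_topology X =
     lc_topology (test_funs X)
       {p. seminorm_on (test_funs X) p \<and>
           (\<forall>K. compact K \<and> K \<subseteq> X \<longrightarrow>
              continuous_map (test_funs_in_topology K) euclideanreal p)}"


section \<open>Distributions\<close>

text \<open>
  A distribution on \<open>X\<close> is represented by a functional which is zero outside \<open>test_funs X\<close>, so that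
  equality of distributions is equality of functions.
\<close>

definition distributions :: "(real^'n) set \<Rightarrow> ((real^'n \<Rightarrow> complex) \<Rightarrow> complex) set" where
  "distributions X = {u.
     (\<forall>\<phi>. \<phi> \<notin> test_funs X \<longrightarrow> u \<phi> = 0) \<and>
     (\<forall>\<phi>\<in>test_funs X. \<forall>\<theta>\<in>test_funs X. u (\<phi> + \<theta>) = u \<phi> + u \<theta>) \<and>
     (\<forall>c. \<forall>\<phi>\<in>test_funs X. u (cscale c \<phi>) = c * u \<phi>) \<and>
     continuous_map (test_topology X) euclidean u}"

text \<open>
  The strong dual topology. The condition \<open>B \<noteq> {}\<close> only avoids the supremum of the empty set.
\<close>

definition strong_topology :: "(real^'n) set \<Rightarrow> ((real^'n \<Rightarrow> complex) \<Rightarrow> complex) topology" where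
  "strong_topology X =
     lc_topology (distributions X)
       {(\<lambda>u. SUP \<phi>\<in>B. cmod (u \<phi>)) | B. B \<noteq> {} \<and> lc_bounded (test_topology X) B}"

definition restr ::
  "(real^'n) set \<Rightarrow> ((real^'n \<Rightarrow> complex) \<Rightarrow> complex) \<Rightarrow> (real^'n \<Rightarrow> complex) \<Rightarrow> complex" where
  "restr Y u = (\<lambda>\<phi>. if \<phi> \<in> test_funs Y then u \<phi> else 0)"

text \<open>
  In the gluing axiom the open cover is a set \<open>\<U>\<close> of open sets, indexed by itself. For an arbitrary
  indexed cover, compatible distributions on equal members are equal, so this is no restriction;
  see \<open>distribution_sheaf_gluing\<close> below.
\<close>

definition distribution_sheaf ::
  "((real^'n) set \<Rightarrow> ((real^'n \<Rightarrow> complex) \<Rightarrow> complex) set) \<Rightarrow> bool" where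
  "distribution_sheaf G \<longleftrightarrow>
     (\<forall>X. open X \<longrightarrow> G X \<subseteq> distributions X \<and> cfun.subspace (G X)) \<and>
     (\<forall>X Y. open X \<and> open Y \<and> Y \<subseteq> X \<longrightarrow> restr Y ` G X \<subseteq> G Y) \<and>
     (\<forall>X \<U> u. open X \<and> (\<forall>U\<in>\<U>. open U) \<and> \<Union>\<U> = X \<and> (\<forall>U\<in>\<U>. u U \<in> G U) \<and>
         (\<forall>U\<in>\<U>. \<forall>V\<in>\<U>. restr (U \<inter> V) (u U) = restr (U \<inter> V) (u V)) \<longrightarrow>
         (\<exists>v\<in>G X. \<forall>U\<in>\<U>. restr U v = u U))"

definition sheaf_topology ::
  "((real^'n) set \<Rightarrow> ((real^'n \<Rightarrow> complex) \<Rightarrow> complex) set) \<Rightarrow> (real^'n) set \<Rightarrow>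
   ((real^'n \<Rightarrow> complex) \<Rightarrow> complex) topology" where
  "sheaf_topology G X = subtopology (strong_topology X) (G X)"

lemma restr_distribution: "u \<in> distributions X \<Longrightarrow> restr X u = u"
  by (auto simp: restr_def distributions_def fun_eq_iff)

lemma distribution_sheaf_gluing:
  assumes G: "distribution_sheaf G"
    and X: "open X" "\<And>i. i \<in> I \<Longrightarrow> open (U i)" "(\<Union>i\<in>I. U i) = X"
    and u: "\<And>i. i \<in> I \<Longrightarrow> u i \<in> G (U i)"
    and compat: "\<And>i j. i \<in> I \<Longrightarrow> j \<in> I \<Longrightarrow>
      restr (U i \<inter> U j) (u i) = restr (U i \<inter> U j) (u j)"
  shows "\<exists>v\<in>G X. \<forall>i\<in>I. restr (U i) v = u i"
proof -
  define v where "v = (\<lambda>V. u (inv_into I U V))"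
  have inv: "inv_into I U (U i) \<in> I" "U (inv_into I U (U i)) = U i" if "i \<in> I" for i
    using that by (simp_all add: inv_into_into f_inv_into_f)
  have dist: "u i \<in> distributions (U i)" if "i \<in> I" for i
    using G X(2) u that by (fastforce simp: distribution_sheaf_def)
  have v_eq: "v (U i) = u i" if "i \<in> I" for i
  proof -
    let ?j = "inv_into I U (U i)"
    have "restr (U i) (u ?j) = restr (U i) (u i)"
      using compat[of ?j i] inv[OF that] that by simp
    then show ?thesis
      using restr_distribution[OF dist, of i] restr_distribution[OF dist, of ?j] inv[OF that] that
      by (simp add: v_def)
  qed
  have glue: "\<forall>X \<U> u. open X \<and> (\<forall>U\<in>\<U>. open U) \<and> \<Union>\<U> = X \<and> (\<forall>U\<in>\<U>. u U \<in> G U) \<and>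
      (\<forall>U\<in>\<U>. \<forall>V\<in>\<U>. restr (U \<inter> V) (u U) = restr (U \<inter> V) (u V)) \<longrightarrow>
      (\<exists>v\<in>G X. \<forall>U\<in>\<U>. restr U v = u U)"
    using G unfolding distribution_sheaf_def by (elim conjE)
  have "\<exists>z\<in>G X. \<forall>V\<in>U ` I. restr V z = v V"
  proof (rule glue[rule_format, of X "U ` I" v], intro conjI)
    show "\<forall>V\<in>U ` I. \<forall>W\<in>U ` I. restr (V \<inter> W) (v V) = restr (V \<inter> W) (v W)"
      unfolding ball_simps using compat v_eq by metis
  qed (use X u v_eq in simp_all)
  then show ?thesis
    by (simp add: v_eq)
qed


section \<open>Weighted composition operators\<close>

text \<open>
  For injective \<open>\<psi>\<close> the continuous extension of \<open>f \<mapsto> w \<cdot> (f \<circ> \<psi>)\<close> to distributions is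
  the transpose of \<open>\<phi> \<mapsto> (\<phi> w / \<bar>det J\<psi>\<bar>) \<circ> \<psi>\<^sup>-\<^sup>1\<close> (extended by zero outside \<open>\<psi> ` X\<close>).
\<close>

definition weighted_comp_transpose ::
  "(real^'n) set \<Rightarrow> (real^'n \<Rightarrow> complex) \<Rightarrow> (real^'n \<Rightarrow> real^'n) \<Rightarrow>
   (real^'n \<Rightarrow> complex) \<Rightarrow> real^'n \<Rightarrow> complex" where
  "weighted_comp_transpose X w \<psi> \<phi> = (\<lambda>y.
     if y \<in> \<psi> ` X
     then (let x = inv_into X \<psi> y
           in \<phi> x * w x / complex_of_real \<bar>det (jacobian \<psi> (at x))\<bar>)
     else 0)"

definition weighted_comp ::
  "(real^'n) set \<Rightarrow> (real^'n \<Rightarrow> complex) \<Rightarrow> (real^'n \<Rightarrow> real^'n) \<Rightarrow>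
   ((real^'n \<Rightarrow> complex) \<Rightarrow> complex) \<Rightarrow> (real^'n \<Rightarrow> complex) \<Rightarrow> complex" where
  "weighted_comp X w \<psi> u =
     (\<lambda>\<phi>. if \<phi> \<in> test_funs X then u (weighted_comp_transpose X w \<psi> \<phi>) else 0)"

definition stable_orbits :: "(real^'n) set \<Rightarrow> (real^'n \<Rightarrow> real^'n) \<Rightarrow> bool" where
  "stable_orbits X \<psi> \<longleftrightarrow>
     (\<forall>K. compact K \<and> K \<subseteq> X \<longrightarrow>
        (\<exists>L. compact L \<and> L \<subseteq> X \<and> (\<forall>m\<ge>1. (\<psi> ^^ m) ` K \<subseteq> L)))"

text \<open>The sequence is indexed from \<open>0\<close> instead of \<open>1\<close>.\<close>

definition rel_compact_exhaustion :: "(real^'n) set \<Rightarrow> (nat \<Rightarrow> (real^'n) set) \<Rightarrow> bool" where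
  "rel_compact_exhaustion X Xs \<longleftrightarrow>
     (\<forall>n. open (Xs n) \<and> compact (closure (Xs n)) \<and> closure (Xs n) \<subseteq> Xs (Suc n)) \<and>
     (\<Union>n. Xs n) = X"

end

theory Submission
  imports Defs
begin

text \<open>
  The operator $C = C_{w,\psi}$ is the transpose of the map $C^t$, written \<open>Ct\<close> below, that sends a
  test function $\varphi$ to $(\varphi w/|\det J\psi|)\circ\psi^{-1}$. Everything rests on two facts. A set of
  test functions is bounded iff its members live on one compact set and each of their derivatives
  is uniformly bounded (\<open>lc_bounded_test_topology_iff\<close>), and a continuous seminorm on the sheaf is
  dominated by a multiple of a single $p_B(u) = \sup_{\varphi\in B}|u(\varphi)|$ with $B$ bounded
  (\<open>continuous_seminorm_sheaf_bound\<close>). Moreover $C^t$ carries bounded sets to bounded sets and moves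
  supports by $\psi$, and $p_B(C^m u) = p_{(C^t)^m B}(u)$.

  Suppose that orbits are stable, and let $B$ be bounded with supports in $K$. All the bounded sets
  $(C^t)^m B$ with $m\ge 1$ live on one compact set $L$. Finitely many seminorms of the Frechet space
  of test functions on $L$ are needed at a time, so a diagonal choice of $\gamma_m>0$ makes
  $D=\bigcup_m \gamma_m^{-1}(C^t)^m B$ bounded (\<open>rescaling_of_bounded_sets\<close>). Then
  $p_B(C^m u)\le\gamma_m\,p_D(u)$, with the seminorm $p_D$ the same for all $m$.

  Suppose conversely that $C$ is topologizable but that the orbit of a compact set $K$ meets the
  complement of every member of the exhaustion. Let $X_n\supseteq K$. For each $k$ some $\psi^{m_k}$
  moves a point of $X_n$ outside the closure of $X_k$. By density of the points where the weights
  do not vanish, and by injectivity, there is a small ball around a nearby image point which is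
  covered by the image of an open subset of $X_n$ on which no weight vanishes. A test function
  $\theta_k$ on that ball with $h(\theta_k)\ne 0$ for some local section $h$ is then $(C^t)^{m_k}\varphi_k$
  with $\varphi_k$ supported in the closure of $X_n$ (\<open>escaping_test_fun\<close>, which inverts $C^t$ step by
  step). Rescaling makes $B=\{c_k\varphi_k\}$ bounded. Topologizability bounds $p_B(C^m u)$ by a multiple
  of some $p_{B'}(u)$, where $B'$ lives in some $X_k$; so $|u(\theta_k)|$ is bounded by a multiple of
  $p_{B'}(u)$ on global sections. But the section which is $0$ on $X_k$ and $h$ on the ball is a strong
  limit of restrictions of global sections, and it violates that bound (\<open>sheaf_separation\<close>).
\<close>

section \<open>Families of functions bounded in all derivatives\<close>

definition locally_bounded ::
  "(real^'n) set \<Rightarrow> 'i set \<Rightarrow> ('i \<Rightarrow> real^'n \<Rightarrow> 'b::real_normed_vector) \<Rightarrow> bool" where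
  "locally_bounded S I f \<longleftrightarrow>
     (\<forall>K. compact K \<and> K \<subseteq> S \<longrightarrow> (\<exists>M. \<forall>i\<in>I. \<forall>x\<in>K. norm (f i x) \<le> M))"

text \<open>
  Boundedness of an indexed family in $C^k(S)$, uniformly on compact sets. Since the constant family
  $i \mapsto f$ is bounded for all $k$ iff $f$ is smooth, smoothness of a function and bounds on the
  derivatives of a whole set of functions obey the same closure lemmas, each proved once by induction
  on $k$.
\<close>

primrec Ck_bounded ::
  "nat \<Rightarrow> (real^'n) set \<Rightarrow> 'i set \<Rightarrow> ('i \<Rightarrow> real^'n \<Rightarrow> 'b::real_normed_vector) \<Rightarrow> bool" where
  "Ck_bounded 0 S I f \<longleftrightarrow> locally_bounded S I f"
| "Ck_bounded (Suc k) S I f \<longleftrightarrow> locally_bounded S I f \<and>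
     (\<forall>i\<in>I. \<forall>x\<in>S. f i differentiable at x) \<and>
     (\<forall>j. Ck_bounded k S I (\<lambda>i. partial_deriv j (f i)))"

lemma Ck_bounded_locally_bounded: "Ck_bounded k S I f \<Longrightarrow> locally_bounded S I f"
  by (cases k) auto

lemma Ck_bounded_Suc_imp: "Ck_bounded (Suc k) S I f \<Longrightarrow> Ck_bounded k S I f"
  by (induction k arbitrary: f) auto

lemma Ck_bounded_mono: "Ck_bounded k S I f \<Longrightarrow> T \<subseteq> S \<Longrightarrow> Ck_bounded k T I f"
proof (induction k arbitrary: f)
  case 0
  then show ?case by (auto simp: locally_bounded_def)
next
  case (Suc k)
  have "locally_bounded T I f" using Suc.prems by (auto simp: locally_bounded_def)
  with Suc show ?case by auto
qed

lemma partial_deriv_eq: "(f has_derivative f') (at x) \<Longrightarrow> partial_deriv j f x = f' (axis j 1)"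
  by (metis frechet_derivative_at partial_deriv_def)

lemma partial_deriv_cong_open:
  assumes "open S" "x \<in> S" "\<And>y. y \<in> S \<Longrightarrow> f y = g y"
  shows "partial_deriv j f x = partial_deriv j g x"
proof -
  have "(f has_derivative D) (at x) \<longleftrightarrow> (g has_derivative D) (at x)" for D
    using assms has_derivative_transform_within_open[of f D x UNIV S g]
      has_derivative_transform_within_open[of g D x UNIV S f] by auto
  then show ?thesis by (simp add: partial_deriv_def frechet_derivative_def)
qed

lemma differentiable_cong_open:
  assumes "open S" "x \<in> S" "\<And>y. y \<in> S \<Longrightarrow> f y = g y" "f differentiable at x"
  shows "g differentiable at x"
  using assms by (metis differentiable_def has_derivative_transform_within_open)

lemma Ck_bounded_cong:
  assumes "open S" "\<And>i x. i \<in> I \<Longrightarrow> x \<in> S \<Longrightarrow> f i x = g i x" "Ck_bounded k S I f"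
  shows "Ck_bounded k S I g"
  using assms(2,3)
proof (induction k arbitrary: f g)
  case 0
  then show ?case by (fastforce simp: locally_bounded_def subset_eq)
next
  case (Suc k)
  have "locally_bounded S I g" using Suc.prems by (fastforce simp: locally_bounded_def subset_eq)
  moreover have "g i differentiable at x" if "i \<in> I" "x \<in> S" for i x
    using Suc.prems that differentiable_cong_open[OF assms(1) that(2), of "f i" "g i"] by auto
  moreover have "Ck_bounded k S I (\<lambda>i. partial_deriv j (g i))" for j
  proof (rule Suc.IH)
    show "partial_deriv j (f i) x = partial_deriv j (g i) x" if "i \<in> I" "x \<in> S" for i x
      using Suc.prems that by (intro partial_deriv_cong_open[OF assms(1)]) auto
    show "Ck_bounded k S I (\<lambda>i. partial_deriv j (f i))" using Suc.prems by auto
  qed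
  ultimately show ?case by auto
qed

lemma partial_deriv_const: "partial_deriv j (\<lambda>x. c) = (\<lambda>x. 0)"
  by (rule ext, subst partial_deriv_eq[OF has_derivative_const]) simp

lemma Ck_bounded_const: "Ck_bounded k S I (\<lambda>i x. c)"
proof (induction k arbitrary: c)
  case (Suc k)
  then show ?case by (simp add: locally_bounded_def partial_deriv_const) blast
qed (auto simp: locally_bounded_def)

lemma locally_bounded_add:
  assumes "locally_bounded S I f" "locally_bounded S I g"
  shows "locally_bounded S I (\<lambda>i x. f i x + g i x)"
  unfolding locally_bounded_def
proof (intro allI impI)
  fix K assume K: "compact K \<and> K \<subseteq> S"
  obtain M N where "\<forall>i\<in>I. \<forall>x\<in>K. norm (f i x) \<le> M" "\<forall>i\<in>I. \<forall>x\<in>K. norm (g i x) \<le> N"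
    using assms K unfolding locally_bounded_def by metis
  then show "\<exists>M. \<forall>i\<in>I. \<forall>x\<in>K. norm (f i x + g i x) \<le> M"
    by (intro exI[of _ "M+N"]) (metis add_mono norm_triangle_ineq order_trans)
qed

lemma Ck_bounded_add:
  assumes "open S" "Ck_bounded k S I f" "Ck_bounded k S I g"
  shows "Ck_bounded k S I (\<lambda>i x. f i x + g i x)"
  using assms(2,3)
proof (induction k arbitrary: f g)
  case 0
  then show ?case by (simp add: locally_bounded_add)
next
  case (Suc k)
  have "Ck_bounded k S I (\<lambda>i. partial_deriv j (\<lambda>x. f i x + g i x))" for j
  proof (rule Ck_bounded_cong[OF assms(1)])
    show "Ck_bounded k S I (\<lambda>i x. partial_deriv j (f i) x + partial_deriv j (g i) x)"
      using Suc by auto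
    show "partial_deriv j (f i) x + partial_deriv j (g i) x = partial_deriv j (\<lambda>x. f i x + g i x) x"
      if "i \<in> I" "x \<in> S" for i x
    proof -
      have "((\<lambda>x. f i x + g i x) has_derivative (\<lambda>h. frechet_derivative (f i) (at x) h
         + frechet_derivative (g i) (at x) h)) (at x)"
        using Suc.prems that by (intro has_derivative_add) (auto simp flip: frechet_derivative_works)
      from partial_deriv_eq[OF this] show ?thesis by (simp add: partial_deriv_def)
    qed
  qed
  with Suc.prems show ?case by (auto intro: locally_bounded_add)
qed

lemma Ck_bounded_sum:
  assumes "open S" "\<And>a. a \<in> A \<Longrightarrow> Ck_bounded k S I (f a)"
  shows "Ck_bounded k S I (\<lambda>i x. \<Sum>a\<in>A. f a i x)"
  using assms(2)
  by (induction A rule: infinite_finite_induct)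
    (auto simp: Ck_bounded_const intro!: Ck_bounded_add[OF assms(1)])

lemma Ck_bounded_bilinear:
  assumes "open S" "bounded_bilinear b" "Ck_bounded k S I f" "Ck_bounded k S I g"
  shows "Ck_bounded k S I (\<lambda>i x. b (f i x) (g i x))"
proof -
  have bdd: "locally_bounded S I (\<lambda>i x. b (f i x) (g i x))"
    if fg: "locally_bounded S I f" "locally_bounded S I g" for f g
    unfolding locally_bounded_def
  proof (intro allI impI)
    fix K assume K: "compact K \<and> K \<subseteq> S"
    obtain C where C: "C \<ge> 0" "\<And>x y. norm (b x y) \<le> norm x * norm y * C"
      using bounded_bilinear.nonneg_bounded[OF assms(2)] by blast
    obtain M N where MN: "\<forall>i\<in>I. \<forall>x\<in>K. norm (f i x) \<le> M" "\<forall>i\<in>I. \<forall>x\<in>K. norm (g i x) \<le> N"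
      using fg K unfolding locally_bounded_def by metis
    show "\<exists>M. \<forall>i\<in>I. \<forall>x\<in>K. norm (b (f i x) (g i x)) \<le> M"
    proof (intro exI[of _ "M * N * C"] ballI)
      fix i x assume ix: "i \<in> I" "x \<in> K"
      have "norm (f i x) * norm (g i x) \<le> M * N"
        using MN ix by (intro mult_mono) (auto intro: order_trans[OF norm_ge_zero])
      then show "norm (b (f i x) (g i x)) \<le> M * N * C"
        using C by (meson mult_right_mono order_trans)
    qed
  qed
  show ?thesis
    using assms(3,4)
  proof (induction k arbitrary: f g)
    case 0
    then show ?case using bdd by simp
  next
    case (Suc k)
    have D: "((\<lambda>x. b (f i x) (g i x)) has_derivative (\<lambda>h. b (f i x) (frechet_derivative (g i) (at x) h)
         + b (frechet_derivative (f i) (at x) h) (g i x))) (at x)" if "i \<in> I" "x \<in> S" for i x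
      using Suc.prems that
      by (intro bounded_bilinear.FDERIV[OF assms(2)]) (auto simp flip: frechet_derivative_works)
    have "Ck_bounded k S I (\<lambda>i. partial_deriv j (\<lambda>x. b (f i x) (g i x)))" for j
    proof (rule Ck_bounded_cong[OF assms(1)])
      show "Ck_bounded k S I (\<lambda>i x. b (f i x) (partial_deriv j (g i) x) + b (partial_deriv j (f i) x) (g i x))"
        using Suc.prems Suc.prems[THEN Ck_bounded_Suc_imp]
        by (intro Ck_bounded_add[OF assms(1)] Suc.IH) auto
      show "b (f i x) (partial_deriv j (g i) x) + b (partial_deriv j (f i) x) (g i x)
         = partial_deriv j (\<lambda>x. b (f i x) (g i x)) x"
        if "i \<in> I" "x \<in> S" for i x
        unfolding partial_deriv_eq[OF D[OF that]] by (simp add: partial_deriv_def)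
    qed
    moreover have "(\<lambda>x. b (f i x) (g i x)) differentiable at x" if "i \<in> I" "x \<in> S" for i x
      using D[OF that] unfolding differentiable_def by blast
    moreover have "locally_bounded S I (\<lambda>i x. b (f i x) (g i x))"
      using Suc.prems by (intro bdd) auto
    ultimately show ?case by auto
  qed
qed

lemmas Ck_bounded_mult = Ck_bounded_bilinear[OF _ bounded_bilinear_mult]
lemmas Ck_bounded_scaleR = Ck_bounded_bilinear[OF _ bounded_bilinear_scaleR]

lemma Ck_bounded_linear:
  assumes "open S" "bounded_linear L" "Ck_bounded k S I f"
  shows "Ck_bounded k S I (\<lambda>i x. L (f i x))"
proof -
  have "bounded_bilinear (\<lambda>(r::real) v. r *\<^sub>R L v)"
    using bounded_bilinear.comp[OF bounded_bilinear_scaleR bounded_linear_ident assms(2)] by simp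
  from Ck_bounded_bilinear[OF assms(1) this Ck_bounded_const[of k S I 1] assms(3)]
  show ?thesis by simp
qed

lemma Ck_bounded_prod:
  fixes f :: "'a \<Rightarrow> 'i \<Rightarrow> real^'n \<Rightarrow> 'b::{real_normed_algebra_1,comm_ring_1}"
  assumes "open S" "\<And>a. a \<in> A \<Longrightarrow> Ck_bounded k S I (f a)"
  shows "Ck_bounded k S I (\<lambda>i x. \<Prod>a\<in>A. f a i x)"
  using assms(2)
  by (induction A rule: infinite_finite_induct)
    (auto simp: Ck_bounded_const intro!: Ck_bounded_mult[OF assms(1)])

lemma partial_derivs_Nil [simp]: "partial_derivs [] f = f"
  by (simp add: partial_derivs_def)

lemma partial_derivs_snoc: "partial_derivs (is @ [j]) f = partial_derivs is (partial_deriv j f)"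
  by (simp add: partial_derivs_def)

lemma smooth_on_partial_deriv: "smooth_on S f \<Longrightarrow> smooth_on S (partial_deriv j f)"
  unfolding smooth_on_def partial_derivs_snoc[symmetric] by blast

lemma partial_derivs_Cons: "partial_derivs (j # is) f = partial_deriv j (partial_derivs is f)"
  by (simp add: partial_derivs_def)

lemma smooth_on_partial_derivs: "smooth_on S f \<Longrightarrow> smooth_on S (partial_derivs is f)"
  by (induction "is") (auto simp: partial_derivs_Cons smooth_on_partial_deriv)

lemma smooth_on_differentiable: "smooth_on S f \<Longrightarrow> x \<in> S \<Longrightarrow> f differentiable at x"
  unfolding smooth_on_def by (metis partial_derivs_Nil)

lemma smooth_on_continuous_on: "smooth_on S f \<Longrightarrow> continuous_on S f"
  by (meson continuous_at_imp_continuous_on differentiable_imp_continuous_within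
      smooth_on_differentiable)

text \<open>
  The recursion peels derivatives off from the inside, whereas an iterated partial derivative
  applies its list from the outside; hence the induction over lists from the right.
\<close>

lemma all_Ck_bounded_iff:
  "(\<forall>k. Ck_bounded k S I f) \<longleftrightarrow>
     (\<forall>i\<in>I. smooth_on S (f i)) \<and> (\<forall>is. locally_bounded S I (\<lambda>i. partial_derivs is (f i)))"
proof safe
  assume *: "\<forall>k. Ck_bounded k S I f"
  have D: "\<forall>k. Ck_bounded k S I (\<lambda>i. partial_derivs is (f i))" for "is"
    using *
  proof (induction "is" arbitrary: f rule: rev_induct)
    case (snoc j "is")
    have "\<forall>k. Ck_bounded k S I (\<lambda>i. partial_deriv j (f i))"
      using snoc.prems by (metis Ck_bounded.simps(2))
    from snoc.IH[OF this] show ?case by (simp add: partial_derivs_snoc)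
  qed simp
  show "locally_bounded S I (\<lambda>i. partial_derivs is (f i))" for "is"
    using D Ck_bounded_locally_bounded by blast
  show "smooth_on S (f i)" if "i \<in> I" for i
    using D[THEN spec[where x="Suc 0"]] that unfolding smooth_on_def by auto
next
  fix k
  assume "\<forall>i\<in>I. smooth_on S (f i)" "\<forall>is. locally_bounded S I (\<lambda>i. partial_derivs is (f i))"
  then show "Ck_bounded k S I f"
  proof (induction k arbitrary: f)
    case 0
    from 0(2)[THEN spec[where x="[]"]] show ?case by simp
  next
    case (Suc k)
    have "Ck_bounded k S I (\<lambda>i. partial_deriv j (f i))" for j
    proof (rule Suc.IH)
      show "\<forall>is. locally_bounded S I (\<lambda>i. partial_derivs is (partial_deriv j (f i)))"
        unfolding partial_derivs_snoc[symmetric] using Suc.prems by blast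
    qed (use Suc.prems smooth_on_partial_deriv in blast)
    then show ?case
      using Suc.prems(1) Suc.prems(2)[THEN spec[where x="[]"]] 
      by (auto intro: smooth_on_differentiable)
  qed
qed

lemma locally_bounded_continuous:
  "continuous_on S f \<Longrightarrow> locally_bounded S I (\<lambda>i. f)"
  unfolding locally_bounded_def
proof (intro allI impI)
  fix K assume f: "continuous_on S f" and K: "compact K \<and> K \<subseteq> S"
  then have "bounded (f ` K)"
    by (auto intro!: compact_imp_bounded compact_continuous_image intro: continuous_on_subset)
  then show "\<exists>M. \<forall>i\<in>I. \<forall>x\<in>K. norm (f x) \<le> M" by (auto simp: bounded_iff)
qed

text \<open>
  A derivative of a smooth function is itself differentiable, hence continuous, and so bounded on
  compact sets.
\<close>

lemma smooth_on_imp_Ck_bounded: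
  assumes "smooth_on S f" shows "Ck_bounded k S I (\<lambda>i. f)"
proof -
  have "\<forall>k. Ck_bounded k S I (\<lambda>i. f)"
    unfolding all_Ck_bounded_iff
  proof (intro conjI ballI allI)
    fix "is" :: "'a list"
    have "smooth_on S (partial_derivs is f)" using assms by (rule smooth_on_partial_derivs)
    then have "continuous_on S (partial_derivs is f)" by (rule smooth_on_continuous_on)
    then show "locally_bounded S I (\<lambda>i. partial_derivs is f)" by (rule locally_bounded_continuous)
  qed (rule assms)
  then show ?thesis by blast
qed

lemma smooth_on_Ck_boundedI: "(\<And>k. Ck_bounded k S {()} (\<lambda>i. f)) \<Longrightarrow> smooth_on S f"
  using all_Ck_bounded_iff[of S "{()}" "\<lambda>i. f"] by auto

lemma smooth_on_iff_Ck_bounded: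
  assumes "open S"
  shows "smooth_on S f \<longleftrightarrow> (\<forall>k. Ck_bounded k S {f} (\<lambda>g. g))"
proof
  assume "smooth_on S f"
  from smooth_on_imp_Ck_bounded[OF this, of _ "{f}"]
  show "\<forall>k. Ck_bounded k S {f} (\<lambda>g. g)"
    using Ck_bounded_cong[OF assms, of "{f}" "\<lambda>g. f" "\<lambda>g. g"] by blast
qed (simp add: all_Ck_bounded_iff)

lemma Ck_bounded_image_iff:
  "(\<forall>k. Ck_bounded k S (f ` I) (\<lambda>g. g)) \<longleftrightarrow> (\<forall>k. Ck_bounded k S I f)"
  unfolding all_Ck_bounded_iff by (simp add: locally_bounded_def)

lemma smooth_on_add:
  fixes f g :: "real^'n \<Rightarrow> 'b::real_normed_vector"
  assumes "open S" "smooth_on S f" "smooth_on S g"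
  shows "smooth_on S (\<lambda>x. f x + g x)"
  by (rule smooth_on_Ck_boundedI) (intro Ck_bounded_add smooth_on_imp_Ck_bounded assms)

lemma smooth_on_mult:
  fixes f g :: "real^'n \<Rightarrow> 'b::real_normed_algebra"
  assumes "open S" "smooth_on S f" "smooth_on S g"
  shows "smooth_on S (\<lambda>x. f x * g x)"
  by (rule smooth_on_Ck_boundedI) (intro Ck_bounded_mult smooth_on_imp_Ck_bounded assms)

lemma smooth_on_const: "smooth_on S (\<lambda>x. c)"
  by (rule smooth_on_Ck_boundedI) (intro Ck_bounded_const)

lemma smooth_on_of_real:
  assumes "open S" "smooth_on S f"
  shows "smooth_on S (\<lambda>x. complex_of_real (f x))"
  by (rule smooth_on_Ck_boundedI)
    (intro Ck_bounded_linear[OF _ bounded_linear_of_real] smooth_on_imp_Ck_bounded assms)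

lemma smooth_on_translation: "smooth_on S (\<lambda>y::real^'n. y - x)"
proof (rule smooth_on_Ck_boundedI)
  have "partial_deriv j (\<lambda>y::real^'n. y - x) z = axis j 1" for j z
    by (rule partial_deriv_eq[where f' = "\<lambda>h. h"]) (auto intro!: derivative_eq_intros)
  then have pd: "partial_deriv j (\<lambda>y::real^'n. y - x) = (\<lambda>_. axis j 1)" for j by (rule ext)
  have "locally_bounded S {()} (\<lambda>_ y::real^'n. y - x)"
    by (intro locally_bounded_continuous continuous_intros)
  then show "Ck_bounded k S {()} (\<lambda>_ y::real^'n. y - x)" for k
    by (cases k) (auto simp: pd Ck_bounded_const intro!: derivative_intros)
qed

section \<open>Composition, reciprocals and inverse maps\<close>

lemma linear_axis_sum:
  fixes f :: "real^'n \<Rightarrow> 'b::real_vector"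
  assumes "linear f"
  shows "f v = (\<Sum>l\<in>UNIV. (v $ l) *\<^sub>R f (axis l 1))"
proof -
  have "f v = f (\<Sum>l\<in>UNIV. (v $ l) *\<^sub>R axis l 1)"
    using basis_expansion[of v] by (simp add: scalar_mult_eq_scaleR)
  then show ?thesis using assms by (simp add: linear_sum linear_scale)
qed

text \<open>
  The chain rule expresses a partial derivative of $f_i\circ\sigma$ through the functions
  $\partial_l f_i\circ\sigma$, to which the induction hypothesis applies for the smaller $k$.
\<close>

lemma Ck_bounded_compose:
  assumes "open T" "continuous_on T \<sigma>" "\<sigma> ` T \<subseteq> S"
    and "Ck_bounded k T I (\<lambda>i. \<sigma>)" "Ck_bounded k S I f"
  shows "Ck_bounded k T I (\<lambda>i x. f i (\<sigma> x))"
proof -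
  have bdd: "locally_bounded T I (\<lambda>i x. f i (\<sigma> x))" if "locally_bounded S I f" for f
    unfolding locally_bounded_def
  proof (intro allI impI)
    fix K assume K: "compact K \<and> K \<subseteq> T"
    then have "compact (\<sigma> ` K)" "\<sigma> ` K \<subseteq> S"
      using assms by (auto intro!: compact_continuous_image intro: continuous_on_subset)
    with that show "\<exists>M. \<forall>i\<in>I. \<forall>x\<in>K. norm (f i (\<sigma> x)) \<le> M"
      unfolding locally_bounded_def by (metis imageI)
  qed
  show ?thesis
    using assms(4,5)
  proof (induction k arbitrary: f)
    case 0
    then show ?case using bdd by simp
  next
    case (Suc k)
    have D: "((\<lambda>x. f i (\<sigma> x)) has_derivative
        (\<lambda>h. frechet_derivative (f i) (at (\<sigma> x)) (frechet_derivative \<sigma> (at x) h))) (at x)"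
      if "i \<in> I" "x \<in> T" for i x
      using Suc.prems that assms(3)
      by (intro has_derivative_compose[where g = "f i" and f = \<sigma>])
        (auto simp flip: frechet_derivative_works)
    have "Ck_bounded k T I (\<lambda>i. partial_deriv j (\<lambda>x. f i (\<sigma> x)))" for j
    proof (rule Ck_bounded_cong[OF assms(1)])
      have "Ck_bounded k T I (\<lambda>i x. partial_deriv j \<sigma> x $ l)" for l
        using Suc.prems by (intro Ck_bounded_linear[OF assms(1) bounded_linear_vec_nth]) auto
      then show "Ck_bounded k T I
          (\<lambda>i x. \<Sum>l\<in>UNIV. (partial_deriv j \<sigma> x $ l) *\<^sub>R partial_deriv l (f i) (\<sigma> x))"
        using Suc.prems(2) Suc.prems(1)[THEN Ck_bounded_Suc_imp]
        by (intro Ck_bounded_sum Ck_bounded_scaleR assms Suc.IH) auto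
      show "(\<Sum>l\<in>UNIV. (partial_deriv j \<sigma> x $ l) *\<^sub>R partial_deriv l (f i) (\<sigma> x))
          = partial_deriv j (\<lambda>x. f i (\<sigma> x)) x" if "i \<in> I" "x \<in> T" for i x
      proof -
        have "f i differentiable at (\<sigma> x)" using Suc.prems that assms(3) by auto
        then have "linear (frechet_derivative (f i) (at (\<sigma> x)))"
          by (rule linear_frechet_derivative)
        from linear_axis_sum[OF this, of "frechet_derivative \<sigma> (at x) (axis j 1)"] show ?thesis
          unfolding partial_deriv_eq[OF D[OF that]] by (simp only: partial_deriv_def)
      qed
    qed
    moreover have "(\<lambda>x. f i (\<sigma> x)) differentiable at x" if "i \<in> I" "x \<in> T" for i x
      using D[OF that] by (auto simp: differentiable_def)
    ultimately show ?case using bdd[of f] Suc.prems by auto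
  qed
qed

text \<open>
  The derivative $-f^{-1}\,\partial_j f\,f^{-1}$ contains only smooth functions and the reciprocal
  itself, so a $C^k$ bound for the reciprocal gives a $C^{k+1}$ bound.
\<close>

lemma Ck_bounded_reciprocal:
  fixes f :: "real^'n \<Rightarrow> 'b::real_normed_field"
  assumes "open S" "smooth_on S f" "\<And>x. x \<in> S \<Longrightarrow> f x \<noteq> 0"
  shows "Ck_bounded k S I (\<lambda>i x. inverse (f x))"
proof (induction k)
  have bdd: "locally_bounded S I (\<lambda>i x. inverse (f x))"
    using assms by (intro locally_bounded_continuous continuous_intros smooth_on_continuous_on) auto
  case 0
  then show ?case using bdd by simp
  case (Suc k)
  have D: "((\<lambda>x. inverse (f x)) has_derivative
      (\<lambda>h. - (inverse (f x) * frechet_derivative f (at x) h * inverse (f x)))) (at x)"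
    if "x \<in> S" for x
    using assms that smooth_on_differentiable[OF assms(2)]
    by (intro Deriv.has_derivative_inverse) (auto simp flip: frechet_derivative_works)
  have "Ck_bounded k S I (\<lambda>i. partial_deriv j (\<lambda>x. inverse (f x)))" for j
  proof (rule Ck_bounded_cong[OF assms(1)])
    show "Ck_bounded k S I (\<lambda>i x. (-1) * (inverse (f x) * partial_deriv j f x * inverse (f x)))"
      by (intro Ck_bounded_mult assms(1) Ck_bounded_const Suc
          smooth_on_imp_Ck_bounded[OF smooth_on_partial_deriv[OF assms(2)]])
    show "(-1) * (inverse (f x) * partial_deriv j f x * inverse (f x))
        = partial_deriv j (\<lambda>x. inverse (f x)) x" if "x \<in> S" for x
      unfolding partial_deriv_eq[OF D[OF that]] by (simp add: partial_deriv_def)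
  qed
  with bdd D show ?case by (auto simp: differentiable_def)
qed

text \<open>
  The same bootstrapping as for reciprocals: away from zeros
  $\partial_j|f| = f^{-1}\,|f|\,\partial_j f$.
\<close>

lemma Ck_bounded_abs:
  fixes f :: "real^'n \<Rightarrow> real"
  assumes "open S" "smooth_on S f" "\<And>x. x \<in> S \<Longrightarrow> f x \<noteq> 0"
  shows "Ck_bounded k S I (\<lambda>i x. \<bar>f x\<bar>)"
proof (induction k)
  have bdd: "locally_bounded S I (\<lambda>i x. \<bar>f x\<bar>)"
    using assms by (intro locally_bounded_continuous continuous_intros smooth_on_continuous_on) auto
  case 0
  then show ?case using bdd by simp
  case (Suc k)
  have D: "((\<lambda>x. \<bar>f x\<bar>) has_derivative (\<lambda>h. sgn (f x) * frechet_derivative f (at x) h)) (at x)"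
    if "x \<in> S" for x
  proof -
    have "(abs has_derivative (\<lambda>h. sgn (f x) * h)) (at (f x))"
      using has_derivative_norm[of "f x"] assms(3)[OF that]
      by (simp add: mult.commute real_norm_def[abs_def])
    moreover have "(f has_derivative frechet_derivative f (at x)) (at x)"
      using smooth_on_differentiable[OF assms(2) that] by (simp flip: frechet_derivative_works)
    ultimately show ?thesis using has_derivative_compose by blast
  qed
  have "Ck_bounded k S I (\<lambda>i. partial_deriv j (\<lambda>x. \<bar>f x\<bar>))" for j
  proof (rule Ck_bounded_cong[OF assms(1)])
    show "Ck_bounded k S I (\<lambda>i x. inverse (f x) * \<bar>f x\<bar> * partial_deriv j f x)"
      by (intro Ck_bounded_mult assms(1) Ck_bounded_reciprocal[OF assms] Suc
          smooth_on_imp_Ck_bounded[OF smooth_on_partial_deriv[OF assms(2)]])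
    show "inverse (f x) * \<bar>f x\<bar> * partial_deriv j f x
        = partial_deriv j (\<lambda>x. \<bar>f x\<bar>) x" if "x \<in> S" for x
      unfolding partial_deriv_eq[OF D[OF that]] using assms(3)[OF that]
      by (simp add: partial_deriv_def sgn_if)
  qed
  with bdd D show ?case by (auto simp: differentiable_def)
qed

lemma Ck_bounded_det:
  fixes M :: "'i \<Rightarrow> real^'n \<Rightarrow> real^'m^'m"
  assumes "open S" "\<And>a b. Ck_bounded k S I (\<lambda>i x. M i x $ a $ b)"
  shows "Ck_bounded k S I (\<lambda>i x. det (M i x))"
  unfolding det_def
  by (intro Ck_bounded_sum Ck_bounded_mult Ck_bounded_const Ck_bounded_prod assms)

lemma jacobian_entry: "jacobian \<psi> (at x) $ a $ b = partial_deriv b \<psi> x $ a"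
  by (simp add: jacobian_def matrix_def partial_deriv_def)

lemma Ck_bounded_jacobian_entry:
  assumes "open S" "smooth_on S \<psi>"
  shows "Ck_bounded k S I (\<lambda>i x. jacobian \<psi> (at x) $ a $ b)"
  unfolding jacobian_entry
  by (intro Ck_bounded_linear[OF _ bounded_linear_vec_nth] smooth_on_imp_Ck_bounded
      smooth_on_partial_deriv assms)

lemma smooth_on_det_jacobian:
  fixes \<psi> :: "real^'n \<Rightarrow> real^'n"
  assumes "open S" "smooth_on S \<psi>"
  shows "smooth_on S (\<lambda>x. det (jacobian \<psi> (at x)))"
  by (intro smooth_on_Ck_boundedI Ck_bounded_det Ck_bounded_jacobian_entry assms)

lemma smooth_on_abs_det:
  fixes \<psi> :: "real^'n \<Rightarrow> real^'n"
  assumes "open S" "smooth_on S \<psi>" "\<forall>x\<in>S. det (jacobian \<psi> (at x)) \<noteq> 0"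
  shows "smooth_on S (\<lambda>x. \<bar>det (jacobian \<psi> (at x))\<bar>)"
    "smooth_on S (\<lambda>x. inverse \<bar>det (jacobian \<psi> (at x))\<bar>)"
proof -
  show abs: "smooth_on S (\<lambda>x. \<bar>det (jacobian \<psi> (at x))\<bar>)"
    by (rule smooth_on_Ck_boundedI)
      (use assms in \<open>auto intro!: Ck_bounded_abs smooth_on_det_jacobian\<close>)
  show "smooth_on S (\<lambda>x. inverse \<bar>det (jacobian \<psi> (at x))\<bar>)"
    by (rule smooth_on_Ck_boundedI) (use assms abs in \<open>auto intro!: Ck_bounded_reciprocal\<close>)
qed

text \<open>
  Openness of the image and continuity of the inverse come from invariance of domain, and the
  inverse $\sigma$ is then differentiable. By the rule of Cramer its derivative is $A\circ\sigma$ with $A$ a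
  smooth matrix function, so that a $C^k$ bound for $\sigma$ gives a $C^{k+1}$ bound.
\<close>

lemma Ck_bounded_inverse_map:
  fixes \<psi> :: "real^'n \<Rightarrow> real^'n"
  assumes "open S" "smooth_on S \<psi>" "inj_on \<psi> S" "\<forall>x\<in>S. det (jacobian \<psi> (at x)) \<noteq> 0"
  shows "open (\<psi> ` S)" "continuous_on (\<psi> ` S) (inv_into S \<psi>)"
    "Ck_bounded k (\<psi> ` S) I (\<lambda>i. inv_into S \<psi>)"
proof -
  let ?\<sigma> = "inv_into S \<psi>" and ?J = "\<lambda>x. jacobian \<psi> (at x)"
  have cont: "continuous_on S \<psi>" using assms(2) by (rule smooth_on_continuous_on)
  show op: "open (\<psi> ` S)" using cont assms by (intro invariance_of_domain)
  show c\<sigma>: "continuous_on (\<psi> ` S) ?\<sigma>"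
    using cont assms by (intro continuous_on_inverse_open) auto
  have left_inv: "matrix_inv (?J x) ** ?J x = mat 1" if "x \<in> S" for x
  proof -
    have "\<exists>B. ?J x ** B = mat 1 \<and> B ** ?J x = mat 1"
      using assms(4) that by (simp add: invertible_det_nz flip: invertible_def)
    then show ?thesis unfolding matrix_inv_def by (rule someI2_ex) blast
  qed
  have D: "(?\<sigma> has_derivative (\<lambda>h. matrix_inv (?J x) *v h)) (at (\<psi> x))" if "x \<in> S" for x
  proof (rule has_derivative_inverse_dieudonne[OF assms(1) op cont c\<sigma> _ that])
    show "(\<psi> has_derivative (\<lambda>h. ?J x *v h)) (at x)"
      using smooth_on_differentiable[OF assms(2) that] by (simp add: jacobian_works)
    show "(\<lambda>h. matrix_inv (?J x) *v h) \<circ> (\<lambda>h. ?J x *v h) = id"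
      using left_inv[OF that] by (simp add: fun_eq_iff matrix_vector_mul_assoc)
  qed (use assms in \<open>auto intro: matrix_vector_mul_bounded_linear\<close>)
  \<comment> \<open>The \<open>j\<close>-th column of the inverse Jacobian matrix.\<close>
  define A where "A j x = (\<chi> l. det (\<chi> a b. if b = l then axis j 1 $ a else ?J x $ a $ b)
      / det (?J x))" for j x
  have pd: "partial_deriv j ?\<sigma> (\<psi> x) = A j x" if "x \<in> S" for j x
  proof -
    have "?J x *v (matrix_inv (?J x) *v axis j 1) = axis j 1"
      using matrix_left_right_inverse[of "matrix_inv (?J x)" "?J x"] left_inv[OF that]
      by (simp add: matrix_vector_mul_assoc)
    then show ?thesis
      using cramer[of "?J x"] assms(4) that unfolding A_def partial_deriv_eq[OF D[OF that]] by blast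
  qed
  have A: "Ck_bounded k S I (\<lambda>i x. A j x $ l)" for k j l
  proof -
    have "Ck_bounded k S I (\<lambda>i x. if b = l then axis j 1 $ a else ?J x $ a $ b)" for a b
      using assms(1,2) by (cases "b = l") (simp_all add: Ck_bounded_const Ck_bounded_jacobian_entry)
    then show ?thesis
      using assms unfolding A_def divide_inverse
      by (simp, intro Ck_bounded_mult Ck_bounded_det Ck_bounded_reciprocal smooth_on_det_jacobian) auto
  qed
  have vec: "Ck_bounded k (\<psi> ` S) I (\<lambda>i. f)"
    if "\<And>l. Ck_bounded k (\<psi> ` S) I (\<lambda>i y. f y $ l)" for f :: "real^'n \<Rightarrow> real^'n" and k
  proof -
    have eq: "f = (\<lambda>y. \<Sum>l\<in>UNIV. (f y $ l) *\<^sub>R (axis l 1 :: real^'n))"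
    proof
      show "f y = (\<Sum>l\<in>UNIV. (f y $ l) *\<^sub>R (axis l 1 :: real^'n))" for y
        using basis_expansion[of "f y"] by (simp add: scalar_mult_eq_scaleR)
    qed
    show ?thesis
      by (subst eq) (intro Ck_bounded_sum Ck_bounded_scaleR Ck_bounded_const op that)
  qed
  show "Ck_bounded k (\<psi> ` S) I (\<lambda>i. ?\<sigma>)"
  proof (induction k)
    case 0
    then show ?case by (simp add: locally_bounded_continuous c\<sigma>)
  next
    case (Suc k)
    have "Ck_bounded k (\<psi> ` S) I (\<lambda>i. partial_deriv j ?\<sigma>)" for j
    proof (rule vec, rule Ck_bounded_cong[OF op])
      show "Ck_bounded k (\<psi> ` S) I (\<lambda>i y. A j (?\<sigma> y) $ l)" for l
        by (rule Ck_bounded_compose[OF op c\<sigma> _ Suc A]) (auto intro: inv_into_into)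
      show "A j (?\<sigma> y) $ l = partial_deriv j ?\<sigma> y $ l" if "y \<in> \<psi> ` S" for y l
        using pd[of "?\<sigma> y" j] that by (auto simp: inv_into_into f_inv_into_f)
    qed
    then show ?case using D by (auto simp: locally_bounded_continuous c\<sigma> differentiable_def)
  qed
qed

text \<open>
  The whole space is covered by the open set $S$ and the open complement of $K$, and on the latter all
  functions and their derivatives vanish.
\<close>

lemma Ck_bounded_extend_zero:
  assumes "open S" "closed K" "K \<subseteq> S" "\<And>i x. i \<in> I \<Longrightarrow> x \<notin> K \<Longrightarrow> f i x = 0"
    and "Ck_bounded k S I f"
  shows "Ck_bounded k UNIV I f"
proof -
  have bdd: "locally_bounded UNIV I f"
    if f: "locally_bounded S I f" and zero: "\<And>i x. i \<in> I \<Longrightarrow> x \<notin> K \<Longrightarrow> f i x = 0" for f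
    unfolding locally_bounded_def
  proof (intro allI impI)
    fix Q :: "(real^'a) set" assume "compact Q \<and> Q \<subseteq> UNIV"
    then have "compact (Q \<inter> K) \<and> Q \<inter> K \<subseteq> S" using assms by (auto intro: compact_Int_closed)
    then obtain M where M: "\<forall>i\<in>I. \<forall>x\<in>Q \<inter> K. norm (f i x) \<le> M"
      using f unfolding locally_bounded_def by meson
    have "norm (f i x) \<le> max M 0" if "i \<in> I" "x \<in> Q" for i x
      using M that zero[of i x]
      by (cases "x \<in> K") (auto simp: le_max_iff_disj)
    then show "\<exists>M. \<forall>i\<in>I. \<forall>x\<in>Q. norm (f i x) \<le> M" by blast
  qed
  show ?thesis
    using assms(4,5)
  proof (induction k arbitrary: f)
    case 0
    then show ?case using bdd[of f] by simp
  next
    case (Suc k)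
    have nK: "open (- K)" using assms by auto
    have "f i differentiable at x" if "i \<in> I" for i x
    proof (cases "x \<in> K")
      case True then show ?thesis using Suc.prems assms(3) that by auto
  next
      case False
      then show ?thesis
        using differentiable_cong_open[OF nK, of x "\<lambda>_. 0" "f i"] Suc.prems(1)[OF that] by simp
    qed
    moreover have "partial_deriv j (f i) x = 0" if "i \<in> I" "x \<notin> K" for i j x
      using partial_deriv_cong_open[OF nK, of x "f i" "\<lambda>_. 0" j] Suc.prems(1) that
      by (simp add: partial_deriv_const)
    then have "Ck_bounded k UNIV I (\<lambda>i. partial_deriv j (f i))" for j
      using Suc.prems(2) by (intro Suc.IH) auto
    moreover have "locally_bounded UNIV I f"
      using Suc.prems by (intro bdd) auto
    ultimately show ?case by simp
  qed
qed

section \<open>Seminorms on locally convex spaces\<close>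

lemma seminorm_on_nonneg: "seminorm_on E p \<Longrightarrow> f \<in> E \<Longrightarrow> 0 \<le> p f"
  and seminorm_on_add: "seminorm_on E p \<Longrightarrow> f \<in> E \<Longrightarrow> g \<in> E \<Longrightarrow> p (f + g) \<le> p f + p g"
  and seminorm_on_cscale: "seminorm_on E p \<Longrightarrow> f \<in> E \<Longrightarrow> p (cscale c f) = cmod c * p f"
  by (auto simp: seminorm_on_def)

lemma seminorm_on_subset: "seminorm_on E p \<Longrightarrow> F \<subseteq> E \<Longrightarrow> seminorm_on F p"
  by (auto simp: seminorm_on_def subset_eq)

lemma seminorm_on_diff_commute:
  assumes "cfun.subspace E" "seminorm_on E p" "f \<in> E" "g \<in> E"
  shows "p (f - g) = p (g - f)"
proof -
  have "g - f = cscale (-1) (f - g)" by (auto simp: cscale_def)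
  then show ?thesis
    using seminorm_on_cscale[OF assms(2) cfun.subspace_diff[OF assms(1,3,4)], of "-1"] by simp
qed

lemma seminorm_on_zero:
  assumes "cfun.subspace E" "seminorm_on E p"
  shows "p 0 = 0"
proof -
  have "(0 :: 'a \<Rightarrow> complex) = cscale 0 0" by (auto simp: cscale_def)
  then show ?thesis
    using seminorm_on_cscale[OF assms(2) cfun.subspace_0[OF assms(1)], of 0] by simp
qed

lemma seminorm_on_diff_triangle:
  assumes "cfun.subspace E" "seminorm_on E p" "f \<in> E" "g \<in> E"
  shows "p f \<le> p (f - g) + p g"
  using seminorm_on_add[OF assms(2) cfun.subspace_diff[OF assms(1,3,4)] assms(4)] by simp

lemma openin_lc_topology_basic:
  assumes "p \<in> P" "f \<in> E" "0 < e"
  shows "openin (lc_topology E P) {g \<in> E. p (g - f) < e}"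
  unfolding lc_topology_def using assms by (intro topology_generated_by_Basis) blast

text \<open>
  The generating sets are only a subbase and are centred at arbitrary points; by the triangle
  inequality, each contains a smaller set of the same kind centred at any given point of it.
\<close>

lemma openin_lc_topology_nbhd:
  assumes E: "cfun.subspace E" and P: "\<And>p. p \<in> P \<Longrightarrow> seminorm_on E p"
    and U: "openin (lc_topology E P) U" "f \<in> U"
  shows "\<exists>F e. finite F \<and> F \<subseteq> P \<and> 0 < e \<and> {g \<in> E. \<forall>p\<in>F. p (g - f) < e} \<subseteq> U"
proof -
  have "generate_topology_on
      (insert E {{g \<in> E. p (g - f) < e} | p f e. p \<in> P \<and> f \<in> E \<and> 0 < e}) U"
    using U(1) unfolding lc_topology_def by (rule openin_topology_generated_by)
  then show ?thesis
    using U(2)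
  proof (induction rule: generate_topology_on.induct)
    case (Int a b)
    then have ab: "f \<in> a" "f \<in> b" by auto
    from Int.IH(1)[OF ab(1)] obtain F e where
      F: "finite F" "F \<subseteq> P" "0 < e" "{g \<in> E. \<forall>p\<in>F. p (g - f) < e} \<subseteq> a" by blast
    from Int.IH(2)[OF ab(2)] obtain F' e' where
      F': "finite F'" "F' \<subseteq> P" "0 < e'" "{g \<in> E. \<forall>p\<in>F'. p (g - f) < e'} \<subseteq> b" by blast
    have "{g \<in> E. \<forall>p\<in>F \<union> F'. p (g - f) < min e e'} \<subseteq> a \<inter> b"
      using F(4) F'(4) unfolding min_less_iff_conj by blast
    moreover have "finite (F \<union> F')" "F \<union> F' \<subseteq> P" "0 < min e e'" using F F' by auto
    ultimately show ?case by blast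
  next
    case (UN K)
    then obtain k where k: "k \<in> K" "f \<in> k" by blast
    from UN.IH[OF this] obtain F e where
      F: "finite F" "F \<subseteq> P" "0 < e" "{g \<in> E. \<forall>p\<in>F. p (g - f) < e} \<subseteq> k" by blast
    have "{g \<in> E. \<forall>p\<in>F. p (g - f) < e} \<subseteq> \<Union>K"
      by (rule order_trans[OF F(4)]) (rule Union_upper[OF k(1)])
    with F(1-3) show ?case by (intro exI[of _ F] exI[of _ e] conjI)
  next
    case (Basis s)
    show ?case
    proof (cases "s = E")
      case True
      then show ?thesis by (intro exI[of _ "{}"] exI[of _ 1]) auto
    next
      case False
      with Basis obtain p f0 e where s: "s = {g \<in> E. p (g - f0) < e}" "p \<in> P" "f0 \<in> E" "0 < e"
        by blast
      with Basis have f: "f \<in> E" "p (f - f0) < e" by auto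
      have "p (g - f0) < e" if g: "g \<in> E" "p (g - f) < e - p (f - f0)" for g
      proof -
        have "p (g - f0) \<le> p ((g - f0) - (f - f0)) + p (f - f0)"
          by (intro seminorm_on_diff_triangle[OF E P[OF s(2)]] cfun.subspace_diff[OF E] g f s)
        with g show ?thesis by simp
      qed
      then have "{g \<in> E. \<forall>p'\<in>{p}. p' (g - f) < e - p (f - f0)} \<subseteq> s"
        by (auto simp: s(1))
      moreover have "finite {p}" "{p} \<subseteq> P" "0 < e - p (f - f0)" using s f by auto
      ultimately show ?thesis by (intro exI[of _ "{p}"] exI[of _ "e - p (f - f0)"] conjI)
    qed
  qed simp
qed

text \<open>
  The unit ball of \<open>q\<close> contains a basic neighbourhood of the origin; scaling an arbitrary vector into
  that neighbourhood gives the estimate. The subspace \<open>G\<close> is there for sections of a sheaf, whose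
  topology is induced from all distributions.
\<close>

lemma continuous_seminorm_bound:
  assumes E: "cfun.subspace E" and P: "\<And>p. p \<in> P \<Longrightarrow> seminorm_on E p"
    and G: "cfun.subspace G" "G \<subseteq> E" and q: "seminorm_on G q"
    and cont: "continuous_map (subtopology (lc_topology E P) G) euclideanreal q"
  shows "\<exists>F C. finite F \<and> F \<subseteq> P \<and> 0 < C \<and> (\<forall>f\<in>G. q f \<le> C * (\<Sum>p\<in>F. p f))"
proof -
  have "openin (subtopology (lc_topology E P) G) {f \<in> topspace (subtopology (lc_topology E P) G). q f \<in> {..<1}}"
    using cont by (rule openin_continuous_map_preimage) (simp flip: open_openin)
  moreover have "topspace (subtopology (lc_topology E P) G) = G" using G by auto
  ultimately obtain U where U: "openin (lc_topology E P) U" "{f \<in> G. q f < 1} = U \<inter> G"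
    by (auto simp: openin_subtopology)
  have "q 0 < 1" by (simp only: seminorm_on_zero[OF G(1) q])
  then have "0 \<in> {f \<in> G. q f < 1}" using cfun.subspace_0[OF G(1)] by blast
  then have "0 \<in> U" unfolding U(2) by blast
  have "\<exists>F e. finite F \<and> F \<subseteq> P \<and> 0 < e \<and> {g \<in> E. \<forall>p\<in>F. p (g - 0) < e} \<subseteq> U"
    using E _ U(1) \<open>0 \<in> U\<close> by (rule openin_lc_topology_nbhd) (rule P)
  then obtain F e where
    F: "finite F" "F \<subseteq> P" "0 < e" "{g \<in> E. \<forall>p\<in>F. p g < e} \<subseteq> U"
    by (simp only: diff_zero) (elim exE conjE, rule that)
  have "q f \<le> 1 / e * (\<Sum>p\<in>F. p f)" if f: "f \<in> G" for f
  proof -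
    have fE: "f \<in> E" using f G by auto
    have nn: "0 \<le> p f" if "p \<in> F" for p
      using that F(2) P fE seminorm_on_nonneg by blast
    \<comment> \<open>A number \<open>t\<close> strictly above the sum is positive even if the sum vanishes, so that dividing by it
      is legitimate; the sum itself is reached as the infimum of these \<open>t\<close>.\<close>
    have "q f \<le> 1 / e * t" if t: "(\<Sum>p\<in>F. p f) < t" for t
    proof -
      have "0 \<le> (\<Sum>p\<in>F. p f)" by (intro sum_nonneg nn)
      then have t0: "0 < t" using t by linarith
      define g where "g = cscale (complex_of_real (e / t)) f"
      have gG: "g \<in> G" unfolding g_def using G(1) f by (rule cfun.subspace_scale)
      have "p g < e" if p: "p \<in> F" for p
      proof -
        have "p f \<le> (\<Sum>p\<in>F. p f)" using F(1) nn p by (intro member_le_sum) auto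
        then have "p f < t" using t by simp
        then have "(e / t) * p f < (e / t) * t"
          using F(3) t0 by (intro mult_strict_left_mono) auto
        moreover have "p g = (e / t) * p f"
          using seminorm_on_cscale[OF P fE, of p "complex_of_real (e / t)"] p F(2,3) t0
          unfolding g_def by (auto simp: norm_divide)
        ultimately show ?thesis using t0 by simp
      qed
      with gG G(2) F(4) U(2) have "q g < 1" by blast
      moreover have "q g = (e / t) * q f"
        using seminorm_on_cscale[OF q f, of "complex_of_real (e / t)"] F(3) t0
        unfolding g_def by (auto simp: norm_divide)
      ultimately show ?thesis using F(3) t0 by (simp add: field_simps)
    qed
    then have "q f * e \<le> t" if "(\<Sum>p\<in>F. p f) < t" for t
      using that F(3) by (simp add: field_simps)
    then have "q f * e \<le> (\<Sum>p\<in>F. p f)" by (rule dense_ge)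
    then show ?thesis using F(3) by (simp add: field_simps)
  qed
  then show ?thesis using F(1-3)
    by (intro exI[of _ F] exI[of _ "1 / e"] conjI ballI) simp_all
qed

lemma subtopology_lc_topology_self: "subtopology (lc_topology E P) E = lc_topology E P"
  using subtopology_topspace[of "lc_topology E P"] by simp

lemma sum_bounded_on:
  assumes "finite F" "\<And>p. p \<in> F \<Longrightarrow> \<exists>N. \<forall>x\<in>B. p x \<le> N"
  shows "\<exists>N::real. \<forall>x\<in>B. (\<Sum>p\<in>F. p x) \<le> N"
  using assms
proof (induction F rule: finite_induct)
  case (insert p F)
  then obtain M N where "\<forall>x\<in>B. p x \<le> M" "\<forall>x\<in>B. (\<Sum>p\<in>F. p x) \<le> N" by (metis insertCI)
  then show ?case using insert.hyps by (intro exI[of _ "M + N"]) (auto intro: add_mono)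
qed auto

lemma continuous_seminorm_bounded_on:
  assumes E: "cfun.subspace E" and P: "\<And>p. p \<in> P \<Longrightarrow> seminorm_on E p"
    and q: "seminorm_on E q" and cont: "continuous_map (lc_topology E P) euclideanreal q"
    and B: "B \<subseteq> E" "\<And>p. p \<in> P \<Longrightarrow> \<exists>N. \<forall>f\<in>B. p f \<le> N"
  shows "\<exists>N. \<forall>f\<in>B. q f \<le> N"
proof -
  have "continuous_map (subtopology (lc_topology E P) E) euclideanreal q"
    using cont by (simp only: subtopology_lc_topology_self)
  with E P E subset_refl q
  have "\<exists>F C. finite F \<and> F \<subseteq> P \<and> 0 < C \<and> (\<forall>f\<in>E. q f \<le> C * (\<Sum>p\<in>F. p f))"
    by (rule continuous_seminorm_bound)
  then obtain F C where F: "finite F" "F \<subseteq> P" "0 < C" "\<And>f. f \<in> E \<Longrightarrow> q f \<le> C * (\<Sum>p\<in>F. p f)"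
    by blast
  obtain N where N: "\<forall>f\<in>B. (\<Sum>p\<in>F. p f) \<le> N"
    using sum_bounded_on[OF F(1), of B] B(2) F(2) by (meson subsetD)
  have "q f \<le> C * N" if f: "f \<in> B" for f
  proof -
    have "q f \<le> C * (\<Sum>p\<in>F. p f)" using F(4) B(1) f by blast
    also have "\<dots> \<le> C * N" using N f F(3) by (intro mult_left_mono) auto
    finally show ?thesis .
  qed
  then show ?thesis by blast
qed

lemma dominated_seminorm_continuous:
  assumes E: "cfun.subspace E" and G: "cfun.subspace G" "G \<subseteq> E" and q: "seminorm_on G q"
    and p: "p \<in> P" "seminorm_on E p" "0 \<le> C" "\<And>f. f \<in> G \<Longrightarrow> q f \<le> C * p f"
  shows "continuous_map (subtopology (lc_topology E P) G) euclideanreal q"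
proof -
  let ?T = "subtopology (lc_topology E P) G"
  have ts: "topspace ?T = G" using G by auto
  have "openin ?T {f \<in> G. q f \<in> U}" if U: "open U" for U
  proof (subst openin_subopen, intro ballI)
    fix f assume "f \<in> {f \<in> G. q f \<in> U}"
    then have f: "f \<in> G" "q f \<in> U" by auto
    then obtain e where e: "0 < e" "ball (q f) e \<subseteq> U" using U open_contains_ball by blast
    define V where "V = {g \<in> E. p (g - f) < e / (C + 1)} \<inter> G"
    have "openin ?T V"
      unfolding V_def using f G e p by (intro openin_subtopology_Int openin_lc_topology_basic) auto
    moreover have "V \<subseteq> {f \<in> G. q f \<in> U}"
    proof
      fix g assume "g \<in> V"
      then have g: "g \<in> G" "p (g - f) < e / (C + 1)" by (auto simp: V_def)
      have "\<bar>q f - q g\<bar> \<le> q (g - f)"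
        using seminorm_on_diff_triangle[OF G(1) q f(1) g(1)]
          seminorm_on_diff_triangle[OF G(1) q g(1) f(1)]
          seminorm_on_diff_commute[OF G(1) q f(1) g(1)] by linarith
      also have "\<dots> \<le> C * p (g - f)" using g f G by (intro p cfun.subspace_diff)
      also have "\<dots> \<le> C * (e / (C + 1))" using g p by (intro mult_left_mono) auto
      also have "\<dots> < e" using e p by (simp add: field_simps)
      finally show "g \<in> {f \<in> G. q f \<in> U}" using g e by (auto simp: subset_eq dist_real_def)
    qed
    moreover have "f \<in> V"
    proof -
      have "p (f - f) < e / (C + 1)" using seminorm_on_zero[OF E p(2)] e(1) p(3) by simp
      then show ?thesis using f(1) G(2) unfolding V_def by blast
    qed
    ultimately show "\<exists>T. openin ?T T \<and> f \<in> T \<and> T \<subseteq> {f \<in> G. q f \<in> U}" by blast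
  qed
  then show ?thesis unfolding continuous_map_def ts by (auto simp flip: open_openin)
qed

section \<open>Bounded sets of test functions\<close>

definition test_funs_in :: "(real^'n) set \<Rightarrow> (real^'n \<Rightarrow> complex) set" where
  "test_funs_in K = {\<phi>. smooth_on UNIV \<phi> \<and> supp \<phi> \<subseteq> K}"

lemma test_funs_in_subset: "compact K \<Longrightarrow> K \<subseteq> X \<Longrightarrow> test_funs_in K \<subseteq> test_funs X"
  unfolding test_funs_in_def test_funs_def supp_def
  by (auto simp: compact_eq_bounded_closed intro: bounded_subset)

lemma test_funsE:
  assumes "\<phi> \<in> test_funs X"
  obtains K where "compact K" "K \<subseteq> X" "\<phi> \<in> test_funs_in K"
  using assms that[of "supp \<phi>"] by (auto simp: test_funs_in_def test_funs_def)

lemma supp_subset_iff: "closed K \<Longrightarrow> supp \<phi> \<subseteq> K \<longleftrightarrow> (\<forall>x. x \<notin> K \<longrightarrow> \<phi> x = 0)"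
  unfolding supp_def using closure_minimal[of "{x. \<phi> x \<noteq> 0}" K] closure_subset[of "{x. \<phi> x \<noteq> 0}"]
  by blast

lemma notin_supp: "x \<notin> supp \<phi> \<Longrightarrow> \<phi> x = 0"
  unfolding supp_def using closure_subset[of "{x. \<phi> x \<noteq> 0}"] by blast

lemma subspace_test_funs_in: "cfun.subspace (test_funs_in K)"
proof (rule cfun.subspaceI)
  show "0 \<in> test_funs_in K"
    by (simp add: test_funs_in_def supp_def zero_fun_def smooth_on_const)
  show "f + g \<in> test_funs_in K" if fg: "f \<in> test_funs_in K" "g \<in> test_funs_in K" for f g
  proof -
    have "supp (f + g) \<subseteq> supp f \<union> supp g"
      unfolding supp_def closure_Un[symmetric] by (rule closure_mono) auto
    with fg show ?thesis by (auto simp: test_funs_in_def plus_fun_def smooth_on_add)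
  qed
  show "cscale c f \<in> test_funs_in K" if f: "f \<in> test_funs_in K" for c f
  proof -
    have "supp (cscale c f) \<subseteq> supp f"
      unfolding supp_def by (rule closure_mono) (auto simp: cscale_def)
    with f show ?thesis
      by (auto simp: test_funs_in_def cscale_def intro!: smooth_on_mult smooth_on_const)
  qed
qed

lemma subspace_test_funs: "cfun.subspace (test_funs X)"
proof (rule cfun.subspaceI)
  have sub: "f + g \<in> test_funs X" "cscale c f \<in> test_funs X"
    if fg: "f \<in> test_funs X" "g \<in> test_funs X" for f g c
  proof -
    obtain K L where K: "compact K" "K \<subseteq> X" "f \<in> test_funs_in K"
      and L: "compact L" "L \<subseteq> X" "g \<in> test_funs_in L" using fg by (meson test_funsE)
    have in_KL: "f \<in> test_funs_in (K \<union> L)" "g \<in> test_funs_in (K \<union> L)"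
      using K(3) L(3) by (auto simp: test_funs_in_def)
    have "test_funs_in (K \<union> L) \<subseteq> test_funs X"
      using K L by (intro test_funs_in_subset) auto
    then show "f + g \<in> test_funs X" "cscale c f \<in> test_funs X"
      using in_KL subspace_test_funs_in[of "K \<union> L"]
      by (auto dest: cfun.subspace_add cfun.subspace_scale)
  qed
  show "0 \<in> test_funs X"
    by (simp add: test_funs_def supp_def zero_fun_def smooth_on_const)
  show "f + g \<in> test_funs X" if "f \<in> test_funs X" "g \<in> test_funs X" for f g using sub that by blast
  show "cscale c f \<in> test_funs X" if "f \<in> test_funs X" for c f using sub that by blast
qed

lemma partial_derivs_outside_supp:
  assumes "x \<notin> supp \<phi>"
  shows "partial_derivs is \<phi> x = 0"
  using assms
proof (induction "is" arbitrary: x)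
  case (Cons j "is")
  have "open (- supp \<phi>)" by (simp add: supp_def open_Compl)
  from partial_deriv_cong_open[OF this, of x "partial_derivs is \<phi>" "\<lambda>_. 0" j] Cons
  show ?case by (simp add: partial_derivs_Cons partial_deriv_const)
qed (simp add: notin_supp)

lemma partial_derivs_add:
  assumes "smooth_on UNIV f" "smooth_on UNIV g"
  shows "partial_derivs is (f + g) x = partial_derivs is f x + partial_derivs is g x"
  using assms
proof (induction "is" arbitrary: f g rule: rev_induct)
  case (snoc j "is")
  have "partial_deriv j (f + g) x = (partial_deriv j f + partial_deriv j g) x" for x
  proof -
    have "((\<lambda>x. f x + g x) has_derivative
        (\<lambda>h. frechet_derivative f (at x) h + frechet_derivative g (at x) h)) (at x)"
      using snoc.prems smooth_on_differentiable
      by (intro has_derivative_add) (auto simp flip: frechet_derivative_works)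
    from partial_deriv_eq[OF this] show ?thesis by (simp add: partial_deriv_def plus_fun_def)
  qed
  then have eq: "partial_deriv j (f + g) = partial_deriv j f + partial_deriv j g" by (rule ext)
  show ?case
    unfolding partial_derivs_snoc eq by (intro snoc.IH smooth_on_partial_deriv snoc.prems)
qed simp

lemma partial_derivs_cscale:
  assumes "smooth_on UNIV f"
  shows "partial_derivs is (cscale c f) x = c * partial_derivs is f x"
  using assms
proof (induction "is" arbitrary: f rule: rev_induct)
  case (snoc j "is")
  have "partial_deriv j (cscale c f) x = cscale c (partial_deriv j f) x" for x
  proof -
    have "((\<lambda>x. c * f x) has_derivative (\<lambda>h. c * frechet_derivative f (at x) h)) (at x)"
      using snoc.prems smooth_on_differentiable
      by (intro has_derivative_mult_right) (auto simp flip: frechet_derivative_works)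
    from partial_deriv_eq[OF this] show ?thesis by (simp add: partial_deriv_def cscale_def)
  qed
  then have eq: "partial_deriv j (cscale c f) = cscale c (partial_deriv j f)" by (rule ext)
  show ?case
    unfolding partial_derivs_snoc eq by (intro snoc.IH smooth_on_partial_deriv snoc.prems)
qed (simp add: cscale_def)

definition deriv_sup :: "'n list \<Rightarrow> (real^'n \<Rightarrow> complex) \<Rightarrow> real" where
  "deriv_sup is \<phi> = (SUP x. cmod (partial_derivs is \<phi> x))"

lemma bdd_above_partial_derivs:
  assumes "\<phi> \<in> test_funs X"
  shows "bdd_above (range (\<lambda>x. cmod (partial_derivs is \<phi> x)))"
proof -
  have \<phi>: "smooth_on UNIV \<phi>" "compact (supp \<phi>)" using assms by (auto simp: test_funs_def)
  have "continuous_on (supp \<phi>) (partial_derivs is \<phi>)"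
    using smooth_on_continuous_on[OF smooth_on_partial_derivs[OF \<phi>(1)]] continuous_on_subset by blast
  from compact_imp_bounded[OF compact_continuous_image[OF this \<phi>(2)]]
  obtain M where M: "\<forall>x\<in>supp \<phi>. cmod (partial_derivs is \<phi> x) \<le> M" by (auto simp: bounded_iff)
  have "cmod (partial_derivs is \<phi> x) \<le> max M 0" for x
    using M partial_derivs_outside_supp[of x \<phi> "is"] by (cases "x \<in> supp \<phi>") auto
  then show ?thesis by (intro bdd_aboveI[of _ "max M 0"]) blast
qed

lemma deriv_sup_upper:
  "\<phi> \<in> test_funs X \<Longrightarrow> cmod (partial_derivs is \<phi> x) \<le> deriv_sup is \<phi>"
  unfolding deriv_sup_def by (intro cSUP_upper bdd_above_partial_derivs) auto

lemma deriv_sup_least: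
  "(\<And>x. cmod (partial_derivs is \<phi> x) \<le> M) \<Longrightarrow> deriv_sup is \<phi> \<le> M"
  unfolding deriv_sup_def by (intro cSUP_least) auto

text \<open>
  Both the sup-norms of derivatives and the seminorms of the strong dual are suprema of the moduli
  of a pointwise bounded family of linear functionals.
\<close>

lemma seminorm_on_SUP:
  assumes "A \<noteq> {}" "\<And>f. f \<in> E \<Longrightarrow> bdd_above ((\<lambda>a. cmod (l a f)) ` A)"
    and "\<And>a f g. a \<in> A \<Longrightarrow> f \<in> E \<Longrightarrow> g \<in> E \<Longrightarrow> l a (f + g) = l a f + l a g"
    and "\<And>a c f. a \<in> A \<Longrightarrow> f \<in> E \<Longrightarrow> l a (cscale c f) = c * l a f"
    and E: "cfun.subspace E"
  shows "seminorm_on E (\<lambda>f. SUP a\<in>A. cmod (l a f))"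
  unfolding seminorm_on_def
proof (intro conjI ballI allI)
  have up: "cmod (l a f) \<le> (SUP a\<in>A. cmod (l a f))" if "a \<in> A" "f \<in> E" for a f
    using assms that by (intro cSUP_upper) auto
  show "0 \<le> (SUP a\<in>A. cmod (l a f))" if "f \<in> E" for f
    using assms(1) up that by (meson all_not_in_conv norm_ge_zero order_trans)
  show "(SUP a\<in>A. cmod (l a (f + g))) \<le> (SUP a\<in>A. cmod (l a f)) + (SUP a\<in>A. cmod (l a g))"
    if "f \<in> E" "g \<in> E" for f g
  proof (rule cSUP_least[OF assms(1)])
    fix a assume a: "a \<in> A"
    have "cmod (l a (f + g)) \<le> cmod (l a f) + cmod (l a g)"
      using assms(3)[OF a that] norm_triangle_ineq by simp
    with up[OF a that(1)] up[OF a that(2)] show "cmod (l a (f + g)) \<le> (SUP a\<in>A. cmod (l a f)) + (SUP a\<in>A. cmod (l a g))"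
      by linarith
  qed
  have le: "(SUP a\<in>A. cmod (l a (cscale c f))) \<le> cmod c * (SUP a\<in>A. cmod (l a f))" if "f \<in> E" for c f
    using up that assms(4) by (intro cSUP_least[OF assms(1)]) (auto simp: norm_mult mult_left_mono)
  show "(SUP a\<in>A. cmod (l a (cscale c f))) = cmod c * (SUP a\<in>A. cmod (l a f))" if f: "f \<in> E" for c f
  proof (rule antisym[OF le[OF f]])
    have "0 \<le> (SUP a\<in>A. cmod (l a (cscale 0 f)))"
      using assms(1) up cfun.subspace_scale[OF E f] by (meson all_not_in_conv norm_ge_zero order_trans)
    moreover have "cmod c * cmod (l a f) \<le> (SUP a\<in>A. cmod (l a (cscale c f)))" if "a \<in> A" for a
      using up[OF that cfun.subspace_scale[OF E f, of c]] assms(4)[OF that f] by (simp add: norm_mult)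
    then have "(SUP a\<in>A. cmod (l a f)) \<le> (SUP a\<in>A. cmod (l a (cscale c f))) / cmod c" if "c \<noteq> 0"
      using that by (intro cSUP_least[OF assms(1)]) (simp add: field_simps)
    ultimately show "cmod c * (SUP a\<in>A. cmod (l a f)) \<le> (SUP a\<in>A. cmod (l a (cscale c f)))"
      by (cases "c = 0") (auto simp: field_simps)
  qed
qed

lemma seminorm_on_deriv_sup:
  "seminorm_on (test_funs X) (deriv_sup is)"
  unfolding deriv_sup_def
  by (rule seminorm_on_SUP)
    (auto simp: bdd_above_partial_derivs test_funs_def
      intro!: partial_derivs_add partial_derivs_cscale subspace_test_funs[unfolded test_funs_def])

lemma test_funs_in_topology_eq:
  fixes K :: "(real^'n) set"
  shows "test_funs_in_topology K = lc_topology (test_funs_in K) (range deriv_sup)"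
proof -
  have "{(\<lambda>\<phi>::real^'n \<Rightarrow> complex. SUP x. cmod (partial_derivs is \<phi> x)) | is. True}
      = range deriv_sup"
    by (auto simp: deriv_sup_def[abs_def])
  then show ?thesis by (simp only: test_funs_in_topology_def test_funs_in_def)
qed

lemma seminorm_on_deriv_sup_in:
  assumes "compact K" shows "seminorm_on (test_funs_in K) (deriv_sup is)"
  using seminorm_on_deriv_sup test_funs_in_subset[OF assms subset_UNIV] by (rule seminorm_on_subset)

lemma dominated_continuous_test_funs_in:
  assumes "compact K" "seminorm_on (test_funs_in K) q" "0 \<le> C"
    and "\<And>\<phi>. \<phi> \<in> test_funs_in K \<Longrightarrow> q \<phi> \<le> C * deriv_sup is \<phi>"
  shows "continuous_map (test_funs_in_topology K) euclideanreal q"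
  using dominated_seminorm_continuous[OF subspace_test_funs_in subspace_test_funs_in subset_refl assms(2)
    _ seminorm_on_deriv_sup_in[OF assms(1)] assms(3,4), of "range deriv_sup"]
  by (simp add: test_funs_in_topology_eq subtopology_lc_topology_self)

definition test_seminorms :: "(real^'n) set \<Rightarrow> ((real^'n \<Rightarrow> complex) \<Rightarrow> real) set" where
  "test_seminorms X = {p. seminorm_on (test_funs X) p \<and>
     (\<forall>K. compact K \<and> K \<subseteq> X \<longrightarrow> continuous_map (test_funs_in_topology K) euclideanreal p)}"

lemma test_topology_eq: "test_topology X = lc_topology (test_funs X) (test_seminorms X)"
  by (simp add: test_topology_def test_seminorms_def)

lemma continuous_seminorm_test_topology:
  assumes "p \<in> test_seminorms X"
  shows "continuous_seminorm (test_topology X) p"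
proof -
  have p: "seminorm_on (test_funs X) p" using assms by (simp add: test_seminorms_def)
  from dominated_seminorm_continuous[OF subspace_test_funs subspace_test_funs subset_refl p
    assms p, of 1] p show ?thesis
    by (simp add: test_topology_eq continuous_seminorm_def subtopology_lc_topology_self)
qed

lemma deriv_sup_test_seminorm: "deriv_sup is \<in> test_seminorms X"
  unfolding test_seminorms_def
  using seminorm_on_deriv_sup_in dominated_continuous_test_funs_in[where C = 1 and q = "deriv_sup is"]
  by (auto simp: seminorm_on_deriv_sup)

lemma lc_boundedD: "lc_bounded T B \<Longrightarrow> continuous_seminorm T p \<Longrightarrow> bdd_above (p ` B)"
  by (simp add: lc_bounded_def)

text \<open>
  If no compact set of an exhaustion by compact sets $C_n$ carries $B$, there are $\varphi_n\in B$ and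
  $x_n\notin C_n$ with $\varphi_n(x_n)\ne 0$. Only finitely many $x_n$ lie in a given compact set, so
  $p(f)=\sup_n n\,|f(x_n)|/|\varphi_n(x_n)|$ is a continuous seminorm; but $p(\varphi_n)\ge n$, so $p$ is
  unbounded on $B$.
\<close>

lemma lc_bounded_common_support:
  fixes X :: "(real^'n) set"
  assumes X: "open X" and B: "lc_bounded (test_topology X) B"
  shows "\<exists>K. compact K \<and> K \<subseteq> X \<and> B \<subseteq> test_funs_in K"
proof (rule ccontr)
  assume no: "\<not> ?thesis"
  have BX: "B \<subseteq> test_funs X" using B by (simp add: lc_bounded_def test_topology_eq)
  obtain C where C: "\<And>n. compact (C n)" "\<And>n. C n \<subseteq> X" "\<And>n. C n \<subseteq> interior (C (Suc n))"
    "\<Union>(range C) = X" "\<And>K. \<lbrakk>compact K; K \<subseteq> X\<rbrakk> \<Longrightarrow> \<exists>N. \<forall>n\<ge>N. K \<subseteq> C n"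
    using open_Union_compact_subsets[OF X] by metis
  have "\<exists>\<phi> x. \<phi> \<in> B \<and> x \<notin> C n \<and> \<phi> x \<noteq> 0" for n
  proof -
    obtain \<phi> where \<phi>: "\<phi> \<in> B" "\<phi> \<notin> test_funs_in (C n)" using no C(1,2) by blast
    then have "\<not> supp \<phi> \<subseteq> C n" using BX by (auto simp: test_funs_def test_funs_in_def)
    then show ?thesis using \<phi>(1) supp_subset_iff[OF compact_imp_closed[OF C(1)]] by blast
  qed
  then obtain \<phi> x where \<phi>x: "\<And>n. \<phi> n \<in> B" "\<And>n. x n \<notin> C n" "\<And>n. \<phi> n (x n) \<noteq> 0" by metis
  define l where "l n f = of_nat n / \<phi> n (x n) * f (x n)" for n and f :: "real^'n \<Rightarrow> complex"
  define p where "p f = (SUP n. cmod (l n f))" for f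
  define A where "A N = (\<Sum>n<N. cmod (of_nat n / \<phi> n (x n)))" for N
  have A0: "0 \<le> A N" for N unfolding A_def by (intro sum_nonneg) auto
  have l_le: "cmod (l n f) \<le> A N * deriv_sup [] f"
    if f: "f \<in> test_funs_in K" "compact K" and N: "\<forall>n\<ge>N. K \<subseteq> C n" for n N f K
  proof -
    have f': "f \<in> test_funs UNIV" using f test_funs_in_subset by blast
    have nn: "0 \<le> deriv_sup [] f"
      using deriv_sup_upper[OF f', of "[]" 0] norm_ge_zero order_trans by blast
    show ?thesis
    proof (cases "n < N")
      case True
      have "cmod (of_nat n / \<phi> n (x n)) \<le> A N"
        unfolding A_def using True by (intro member_le_sum) auto
      moreover have "cmod (f (x n)) \<le> deriv_sup [] f"
        using deriv_sup_upper[OF f', of "[]" "x n"] by simp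
      ultimately show ?thesis unfolding l_def norm_mult using A0 by (intro mult_mono) auto
    next
      case False
      then have "K \<subseteq> C n" using N by simp
      then have "x n \<notin> supp f" using f \<phi>x(2)[of n] by (auto simp: test_funs_in_def)
      then show ?thesis using A0 nn by (simp add: l_def notin_supp)
    qed
  qed
  have sem: "seminorm_on (test_funs X) p"
    unfolding p_def
  proof (rule seminorm_on_SUP)
    fix f assume "f \<in> test_funs X"
    then obtain K where K: "compact K" "K \<subseteq> X" "f \<in> test_funs_in K" by (rule test_funsE)
    from C(5)[OF K(1,2)] obtain N where "\<forall>n\<ge>N. K \<subseteq> C n" by blast
    from l_le[OF K(3,1) this] show "bdd_above (range (\<lambda>n. cmod (l n f)))"
      by (intro bdd_aboveI[of _ "A N * deriv_sup [] f"]) blast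
  qed (auto simp: l_def ring_distribs add_divide_distrib cscale_def subspace_test_funs)
  have "p \<in> test_seminorms X"
    unfolding test_seminorms_def
  proof (intro CollectI conjI sem allI impI)
    fix K assume K: "compact K \<and> K \<subseteq> X"
    then obtain N where N: "\<forall>n\<ge>N. K \<subseteq> C n" using C(5) by blast
    show "continuous_map (test_funs_in_topology K) euclideanreal p"
    proof (rule dominated_continuous_test_funs_in)
      show "seminorm_on (test_funs_in K) p"
        using sem K by (intro seminorm_on_subset[OF sem] test_funs_in_subset) auto
      show "p f \<le> A N * deriv_sup [] f" if "f \<in> test_funs_in K" for f
        unfolding p_def using l_le[OF that _ N] K by (intro cSUP_least) auto
    qed (use K A0 in auto)
  qed
  then have "bdd_above (p ` B)"
    by (intro lc_boundedD[OF B] continuous_seminorm_test_topology)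
  then obtain M where M: "\<And>f. f \<in> B \<Longrightarrow> p f \<le> M" by (auto simp: bdd_above_def)
  have "real n \<le> M" for n
  proof -
    obtain K where K: "compact K" "K \<subseteq> X" "\<phi> n \<in> test_funs_in K"
      using \<phi>x(1) BX test_funsE by blast
    from C(5)[OF K(1,2)] obtain N where "\<forall>n\<ge>N. K \<subseteq> C n" by blast
    from l_le[OF K(3,1) this] have "bdd_above (range (\<lambda>m. cmod (l m (\<phi> n))))"
      by (intro bdd_aboveI[of _ "A N * deriv_sup [] (\<phi> n)"]) blast
    then have "cmod (l n (\<phi> n)) \<le> p (\<phi> n)" unfolding p_def by (intro cSUP_upper) auto
    also have "\<dots> \<le> M" by (rule M[OF \<phi>x(1)])
    finally show ?thesis using \<phi>x(3)[of n] by (simp add: l_def)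
  qed
  then show False using reals_Archimedean2[of M] by (meson not_less)
qed

text \<open>
  Seminorm bounds are transported twice: from the sup-norms of derivatives to the seminorms that are
  continuous on the functions supported in $K$, and from these to all continuous seminorms.
\<close>

lemma lc_bounded_test_topologyI:
  fixes X :: "(real^'n) set"
  assumes K: "compact K" "K \<subseteq> X" "B \<subseteq> test_funs_in K"
    and bd: "\<And>is. \<exists>M. \<forall>\<phi>\<in>B. \<forall>x. cmod (partial_derivs is \<phi> x) \<le> M"
  shows "lc_bounded (test_topology X) B"
  unfolding lc_bounded_def
proof (intro conjI allI impI)
  have KX: "test_funs_in K \<subseteq> test_funs X" using K by (intro test_funs_in_subset)
  then have BX: "B \<subseteq> test_funs X" using K(3) by blast
  then show "B \<subseteq> topspace (test_topology X)" by (simp add: test_topology_eq)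
  have sup_bdd: "\<exists>N. \<forall>\<phi>\<in>B. q \<phi> \<le> N" if "q \<in> range deriv_sup" for q
    using that bd deriv_sup_least by (metis imageE)
  have test_bdd: "\<exists>N. \<forall>\<phi>\<in>B. q \<phi> \<le> N" if q: "q \<in> test_seminorms X" for q
  proof (rule continuous_seminorm_bounded_on[OF subspace_test_funs_in _ _ _ K(3) sup_bdd])
    show "seminorm_on (test_funs_in K) p" if "p \<in> range deriv_sup" for p
      using that seminorm_on_deriv_sup_in[OF K(1)] by auto
    show "seminorm_on (test_funs_in K) q"
      using q KX by (auto simp: test_seminorms_def intro: seminorm_on_subset)
  qed (use q K in \<open>simp_all add: test_seminorms_def flip: test_funs_in_topology_eq\<close>)
  fix p assume p: "continuous_seminorm (test_topology X) p"
  have "\<exists>N. \<forall>\<phi>\<in>B. p \<phi> \<le> N"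
  proof (rule continuous_seminorm_bounded_on[OF subspace_test_funs _ _ _ BX test_bdd])
    show "seminorm_on (test_funs X) q" if "q \<in> test_seminorms X" for q
      using that by (simp add: test_seminorms_def)
  qed (use p in \<open>simp_all add: continuous_seminorm_def test_topology_eq\<close>)
  then show "bdd_above (p ` B)" by (auto simp: bdd_above_def)
qed

lemma locally_bounded_partial_derivs_iff:
  assumes "compact K" "B \<subseteq> test_funs_in K"
  shows "locally_bounded UNIV B (partial_derivs is) \<longleftrightarrow>
    (\<exists>M. \<forall>\<phi>\<in>B. \<forall>x. cmod (partial_derivs is \<phi> x) \<le> M)"
proof
  assume "locally_bounded UNIV B (partial_derivs is)"
  then obtain M where M: "\<forall>\<phi>\<in>B. \<forall>x\<in>K. cmod (partial_derivs is \<phi> x) \<le> M"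
    using assms(1) unfolding locally_bounded_def by (meson subset_UNIV)
  have "cmod (partial_derivs is \<phi> x) \<le> max M 0" if "\<phi> \<in> B" for \<phi> x
  proof (cases "x \<in> K")
    case False
    then have "x \<notin> supp \<phi>" using assms(2) that by (auto simp: test_funs_in_def)
    then show ?thesis by (simp add: partial_derivs_outside_supp)
  qed (use M that in \<open>auto simp: le_max_iff_disj\<close>)
  then show "\<exists>M. \<forall>\<phi>\<in>B. \<forall>x. cmod (partial_derivs is \<phi> x) \<le> M" by blast
qed (auto simp: locally_bounded_def)

text \<open>
  Consequently a bounded set carried by a compact subset of a smaller open set is bounded there as
  well, since the right-hand side mentions $X$ only through $K$.
\<close>

lemma lc_bounded_test_topology_iff:
  assumes "open X"
  shows "lc_bounded (test_topology X) B \<longleftrightarrow>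
    (\<exists>K. compact K \<and> K \<subseteq> X \<and> B \<subseteq> test_funs_in K \<and> (\<forall>k. Ck_bounded k UNIV B (\<lambda>\<phi>. \<phi>)))"
proof
  assume B: "lc_bounded (test_topology X) B"
  then obtain K where K: "compact K" "K \<subseteq> X" "B \<subseteq> test_funs_in K"
    using lc_bounded_common_support[OF assms] by blast
  have "\<exists>M. \<forall>\<phi>\<in>B. \<forall>x. cmod (partial_derivs is \<phi> x) \<le> M" for "is"
  proof -
    have "bdd_above (deriv_sup is ` B)"
      by (intro lc_boundedD[OF B] continuous_seminorm_test_topology deriv_sup_test_seminorm)
    then obtain M where M: "\<And>\<phi>. \<phi> \<in> B \<Longrightarrow> deriv_sup is \<phi> \<le> M" by (auto simp: bdd_above_def)
    have "B \<subseteq> test_funs X" using K test_funs_in_subset by blast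
    with M show ?thesis by (meson deriv_sup_upper order_trans subsetD)
  qed
  then have "\<forall>k. Ck_bounded k UNIV B (\<lambda>\<phi>. \<phi>)"
    using K(3) unfolding all_Ck_bounded_iff locally_bounded_partial_derivs_iff[OF K(1,3)]
    by (auto simp: test_funs_in_def)
  with K show "\<exists>K. compact K \<and> K \<subseteq> X \<and> B \<subseteq> test_funs_in K \<and> (\<forall>k. Ck_bounded k UNIV B (\<lambda>\<phi>. \<phi>))"
    by blast
next
  assume "\<exists>K. compact K \<and> K \<subseteq> X \<and> B \<subseteq> test_funs_in K \<and> (\<forall>k. Ck_bounded k UNIV B (\<lambda>\<phi>. \<phi>))"
  then obtain K where K: "compact K" "K \<subseteq> X" "B \<subseteq> test_funs_in K"
    "\<forall>k. Ck_bounded k UNIV B (\<lambda>\<phi>. \<phi>)" by blast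
  from K(4) have "locally_bounded UNIV B (partial_derivs is)" for "is"
    unfolding all_Ck_bounded_iff by simp
  then show "lc_bounded (test_topology X) B"
    using locally_bounded_partial_derivs_iff[OF K(1,3)] K(1-3)
    by (intro lc_bounded_test_topologyI) auto
qed

section \<open>The strong dual\<close>

definition dual_sup :: "'a set \<Rightarrow> ('a \<Rightarrow> complex) \<Rightarrow> real" where
  "dual_sup B u = (SUP \<phi>\<in>B. cmod (u \<phi>))"

definition strong_seminorms ::
  "(real^'n) set \<Rightarrow> (((real^'n \<Rightarrow> complex) \<Rightarrow> complex) \<Rightarrow> real) set" where
  "strong_seminorms X = {dual_sup B | B. B \<noteq> {} \<and> lc_bounded (test_topology X) B}"

lemma strong_topology_eq:
  fixes X :: "(real^'n) set"
  shows "strong_topology X = lc_topology (distributions X) (strong_seminorms X)"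
proof -
  have "{(\<lambda>u::(real^'n \<Rightarrow> complex) \<Rightarrow> complex. SUP \<phi>\<in>B. cmod (u \<phi>)) | B.
      B \<noteq> {} \<and> lc_bounded (test_topology X) B} = strong_seminorms X"
    by (simp add: strong_seminorms_def dual_sup_def[abs_def])
  then show ?thesis by (simp only: strong_topology_def)
qed

lemma distributions_add:
    "u \<in> distributions X \<Longrightarrow> \<phi> \<in> test_funs X \<Longrightarrow> \<theta> \<in> test_funs X \<Longrightarrow> u (\<phi> + \<theta>) = u \<phi> + u \<theta>"
  and distributions_cscale:
    "u \<in> distributions X \<Longrightarrow> \<phi> \<in> test_funs X \<Longrightarrow> u (cscale c \<phi>) = c * u \<phi>"
  and distributions_outside: "u \<in> distributions X \<Longrightarrow> \<phi> \<notin> test_funs X \<Longrightarrow> u \<phi> = 0"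
  and distributions_continuous:
    "u \<in> distributions X \<Longrightarrow> continuous_map (test_topology X) euclidean u"
  by (auto simp: distributions_def)

lemma continuous_map_affine_complex:
  fixes u v :: "'a \<Rightarrow> complex"
  assumes "continuous_map T euclidean u" "continuous_map T euclidean v"
  shows "continuous_map T euclidean (\<lambda>x. a * u x + v x)"
proof -
  have "continuous_map euclidean euclidean (\<lambda>z::complex. a * z)"
    by (simp add: continuous_on_mult_left)
  from continuous_map_compose[OF assms(1) this]
  have "continuous_map T euclidean (\<lambda>x. a * u x)" by (simp add: o_def)
  then show ?thesis using assms(2) by (rule continuous_map_add)
qed

lemma subspace_distributions: "cfun.subspace (distributions X)"
proof -
  have comb: "(\<lambda>\<phi>. a * u \<phi> + v \<phi>) \<in> distributions X"
    if u: "u \<in> distributions X" and v: "v \<in> distributions X" for u v a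
    using distributions_add[OF u] distributions_add[OF v] distributions_cscale[OF u]
      distributions_cscale[OF v] distributions_outside[OF u] distributions_outside[OF v]
      continuous_map_affine_complex[OF distributions_continuous[OF u] distributions_continuous[OF v]]
    unfolding distributions_def[of X] by (simp add: algebra_simps)
  have zero: "(\<lambda>\<phi>. 0) \<in> distributions X" by (simp add: distributions_def)
  show ?thesis
  proof (rule cfun.subspaceI)
    show "0 \<in> distributions X" using zero by (simp add: zero_fun_def)
    show "u + v \<in> distributions X" if "u \<in> distributions X" "v \<in> distributions X" for u v
      using comb[OF that, of 1] by (simp add: plus_fun_def)
    show "cscale c u \<in> distributions X" if "u \<in> distributions X" for c u
      using comb[OF that zero, of c] by (simp add: cscale_def)
  qed
qed

text \<open>
  The modulus of a distribution is a continuous seminorm, hence bounded on bounded sets. This makes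
  the suprema of the strong dual topology proper real numbers.
\<close>

lemma bdd_above_dual:
  assumes "u \<in> distributions X" "lc_bounded (test_topology X) B"
  shows "bdd_above ((\<lambda>\<phi>. cmod (u \<phi>)) ` B)"
proof (rule lc_boundedD[OF assms(2)])
  have "continuous_map euclidean euclideanreal (cmod :: complex \<Rightarrow> real)"
    by (simp add: continuous_on_norm)
  from continuous_map_compose[OF distributions_continuous[OF assms(1)] this]
  have "continuous_map (test_topology X) euclideanreal (\<lambda>\<phi>. cmod (u \<phi>))" by (simp add: o_def)
  moreover have "seminorm_on (test_funs X) (\<lambda>\<phi>. cmod (u \<phi>))"
    using distributions_add[OF assms(1)] distributions_cscale[OF assms(1)]
    by (auto simp: seminorm_on_def norm_mult norm_triangle_ineq)
  ultimately show "continuous_seminorm (test_topology X) (\<lambda>\<phi>. cmod (u \<phi>))"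
    by (simp add: continuous_seminorm_def test_topology_eq)
qed

lemma dual_sup_upper:
  assumes "u \<in> distributions X" "lc_bounded (test_topology X) B" "\<phi> \<in> B"
  shows "cmod (u \<phi>) \<le> dual_sup B u"
  unfolding dual_sup_def using assms bdd_above_dual by (intro cSUP_upper)

lemma dual_sup_least:
  "B \<noteq> {} \<Longrightarrow> (\<And>\<phi>. \<phi> \<in> B \<Longrightarrow> cmod (u \<phi>) \<le> M) \<Longrightarrow> dual_sup B u \<le> M"
  unfolding dual_sup_def by (rule cSUP_least)

lemma seminorm_on_dual_sup:
  assumes "B \<noteq> {}" "lc_bounded (test_topology X) B"
  shows "seminorm_on (distributions X) (dual_sup B)"
  unfolding dual_sup_def
  using assms bdd_above_dual subspace_distributions
  by (intro seminorm_on_SUP) (auto simp: cscale_def)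

lemma seminorm_on_strong: "p \<in> strong_seminorms X \<Longrightarrow> seminorm_on (distributions X) p"
  unfolding strong_seminorms_def using seminorm_on_dual_sup by blast

lemma lc_bounded_Un: "lc_bounded T A \<Longrightarrow> lc_bounded T B \<Longrightarrow> lc_bounded T (A \<union> B)"
  by (auto simp: lc_bounded_def image_Un)

lemma lc_bounded_singleton: "f \<in> topspace T \<Longrightarrow> lc_bounded T {f}"
  by (simp add: lc_bounded_def)

text \<open>
  The seminorms of the strong dual are directed, because the union of two bounded sets is bounded.
\<close>

lemma strong_seminorms_sum_bound:
  assumes "finite F" "F \<subseteq> strong_seminorms X"
  shows "\<exists>B C. B \<noteq> {} \<and> lc_bounded (test_topology X) B \<and> 0 < C \<and>
    (\<forall>u\<in>distributions X. (\<Sum>p\<in>F. p u) \<le> C * dual_sup B u)"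
  using assms
proof (induction F rule: finite_induct)
  case empty
  have "lc_bounded (test_topology X) {0}"
    using cfun.subspace_0[OF subspace_test_funs]
    by (intro lc_bounded_singleton) (simp add: test_topology_eq)
  \<comment> \<open>The set \<open>{0}\<close> is used because the supremum over the empty set is unspecified.\<close>
  then show ?case by (intro exI[of _ "{0}"] exI[of _ 1]) (simp add: dual_sup_def)
next
  case (insert p F)
  then obtain B C where B: "B \<noteq> {}" "lc_bounded (test_topology X) B" "0 < C"
    "\<forall>u\<in>distributions X. (\<Sum>p\<in>F. p u) \<le> C * dual_sup B u" by auto
  obtain B' where B': "p = dual_sup B'" "B' \<noteq> {}" "lc_bounded (test_topology X) B'"
    using insert.prems by (auto simp: strong_seminorms_def)
  have bd: "lc_bounded (test_topology X) (B \<union> B')" using B B' by (intro lc_bounded_Un)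
  have "(\<Sum>p\<in>insert p F. p u) \<le> (1 + C) * dual_sup (B \<union> B') u" if u: "u \<in> distributions X" for u
  proof -
    have "dual_sup B u \<le> dual_sup (B \<union> B') u" "p u \<le> dual_sup (B \<union> B') u"
      unfolding B'(1) using B B' dual_sup_upper[OF u bd] by (auto intro!: dual_sup_least)
    moreover have "(\<Sum>p\<in>insert p F. p u) \<le> p u + C * dual_sup B u"
      using insert.hyps B(4) u by simp
    moreover have "C * dual_sup B u \<le> C * dual_sup (B \<union> B') u"
      using calculation(1) B(3) by (intro mult_left_mono) auto
    ultimately show ?thesis by (simp add: algebra_simps)
  qed
  then show ?case using B bd by (intro exI[of _ "B \<union> B'"] exI[of _ "1 + C"]) simp
qed

lemma topspace_sheaf_topology:
  "G X \<subseteq> distributions X \<Longrightarrow> topspace (sheaf_topology G X) = G X"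
  by (auto simp: sheaf_topology_def strong_topology_eq)

lemma continuous_seminorm_sheaf_bound:
  assumes G: "G X \<subseteq> distributions X" "cfun.subspace (G X)"
    and p: "continuous_seminorm (sheaf_topology G X) p"
  shows "\<exists>B C. B \<noteq> {} \<and> lc_bounded (test_topology X) B \<and> 0 < C \<and>
    (\<forall>u\<in>G X. p u \<le> C * dual_sup B u)"
proof -
  have "\<exists>F C. finite F \<and> F \<subseteq> strong_seminorms X \<and> 0 < C \<and>
      (\<forall>u\<in>G X. p u \<le> C * (\<Sum>q\<in>F. q u))"
  proof (rule continuous_seminorm_bound[OF subspace_distributions _ G(2,1)])
    show "seminorm_on (G X) p"
      using p G by (simp add: continuous_seminorm_def topspace_sheaf_topology)
    show "continuous_map (subtopology (lc_topology (distributions X) (strong_seminorms X)) (G X))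
        euclideanreal p"
      using p by (simp only: continuous_seminorm_def sheaf_topology_def strong_topology_eq)
  qed (rule seminorm_on_strong)
  then obtain F C where F: "finite F" "F \<subseteq> strong_seminorms X" "0 < C"
    "\<And>u. u \<in> G X \<Longrightarrow> p u \<le> C * (\<Sum>q\<in>F. q u)" by blast
  obtain B C' where B: "B \<noteq> {}" "lc_bounded (test_topology X) B" "0 < C'"
    "\<And>u. u \<in> distributions X \<Longrightarrow> (\<Sum>p\<in>F. p u) \<le> C' * dual_sup B u"
    using strong_seminorms_sum_bound[OF F(1,2)] by blast
  have "p u \<le> C * C' * dual_sup B u" if u: "u \<in> G X" for u
  proof -
    have "C * (\<Sum>q\<in>F. q u) \<le> C * (C' * dual_sup B u)"
      using B(4)[of u] u G(1) F(3) by (intro mult_left_mono) auto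
    with F(4)[OF u] show ?thesis by simp
  qed
  moreover have "0 < C * C'" using F(3) B(3) by simp
  ultimately show ?thesis using B(1,2) by blast
qed

lemma continuous_seminorm_dual_sup:
  assumes G: "G X \<subseteq> distributions X" "cfun.subspace (G X)"
    and B: "B \<noteq> {}" "lc_bounded (test_topology X) B"
  shows "continuous_seminorm (sheaf_topology G X) (dual_sup B)"
proof -
  have s: "seminorm_on (G X) (dual_sup B)"
    using seminorm_on_dual_sup[OF B] G(1) by (rule seminorm_on_subset)
  have "continuous_map (subtopology (lc_topology (distributions X) (strong_seminorms X)) (G X))
      euclideanreal (dual_sup B)"
    by (rule dominated_seminorm_continuous[OF subspace_distributions G(2,1) s, where C = 1])
      (use B seminorm_on_dual_sup[OF B] in \<open>auto simp: strong_seminorms_def\<close>)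
  with s show ?thesis
    unfolding continuous_seminorm_def topspace_sheaf_topology[of G X, OF G(1)]
    by (simp only: sheaf_topology_def strong_topology_eq)
qed

lemma openin_sheaf_topology_dual_ball:
  assumes "v \<in> distributions X" "B \<noteq> {}" "lc_bounded (test_topology X) B" "0 < e"
  shows "openin (sheaf_topology G X) ({u \<in> distributions X. dual_sup B (u - v) < e} \<inter> G X)"
  unfolding sheaf_topology_def strong_topology_eq using assms
  by (intro openin_subtopology_Int openin_lc_topology_basic) (auto simp: strong_seminorms_def)

text \<open>
  The countability condition of Mackey for the metrizable space of test functions supported in $K$: if
  $\gamma_m$ exceeds the bounds on $B_m$ of all derivatives of order at most $m$, then for a fixed derivative
  all but finitely many of the rescaled sets satisfy the bound $1$.
\<close>

lemma rescaling_of_bounded_sets: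
  fixes B :: "nat \<Rightarrow> (real^'n \<Rightarrow> complex) set"
  assumes K: "compact K" "K \<subseteq> X" "\<And>m. B m \<subseteq> test_funs_in K"
    and X: "open X" and bd: "\<And>m. lc_bounded (test_topology X) (B m)"
  shows "\<exists>\<gamma>. (\<forall>m. 0 < \<gamma> m) \<and>
    lc_bounded (test_topology X) (\<Union>m. cscale (complex_of_real (inverse (\<gamma> m))) ` B m)"
proof -
  have "\<exists>M. \<forall>\<phi>\<in>B m. \<forall>x. cmod (partial_derivs is \<phi> x) \<le> M" for m "is"
  proof -
    have "\<forall>k. Ck_bounded k UNIV (B m) (\<lambda>\<phi>. \<phi>)" using bd lc_bounded_test_topology_iff[OF X] by blast
    then show ?thesis
      unfolding all_Ck_bounded_iff using locally_bounded_partial_derivs_iff[OF K(1,3)] by blast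
  qed
  then obtain M where M: "\<And>m is \<phi> x. \<phi> \<in> B m \<Longrightarrow> cmod (partial_derivs is \<phi> x) \<le> M m is" by metis
  define Ls where "Ls m = {is :: 'n list. set is \<subseteq> UNIV \<and> length is \<le> m}" for m
  have fin: "finite (Ls m)" for m unfolding Ls_def by (rule finite_lists_length_le) simp
  define \<gamma> where "\<gamma> m = 1 + (\<Sum>is\<in>Ls m. \<bar>M m is\<bar>)" for m
  have \<gamma>1: "1 \<le> \<gamma> m" for m unfolding \<gamma>_def by (simp add: sum_nonneg)
  let ?D = "\<Union>m. cscale (complex_of_real (inverse (\<gamma> m))) ` B m"
  have "lc_bounded (test_topology X) ?D"
  proof (rule lc_bounded_test_topologyI[OF K(1,2)])
    show "?D \<subseteq> test_funs_in K"
      using K(3) subspace_test_funs_in[of K] by (auto intro: cfun.subspace_scale)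
    fix "is" :: "'n list"
    define N where "N = 1 + (\<Sum>m<length is. \<bar>M m is\<bar>)"
    have N1: "1 \<le> N" unfolding N_def by (simp add: sum_nonneg)
    have "M m is \<le> N * \<gamma> m" for m
    proof (cases "m < length is")
      case True
      then have "\<bar>M m is\<bar> \<le> (\<Sum>m<length is. \<bar>M m is\<bar>)" by (intro member_le_sum) auto
      then have "M m is \<le> N * 1" by (simp add: N_def)
      also have "\<dots> \<le> N * \<gamma> m" using N1 \<gamma>1 by (intro mult_left_mono) auto
      finally show ?thesis .
    next
      case False
      then have "\<bar>M m is\<bar> \<le> (\<Sum>is\<in>Ls m. \<bar>M m is\<bar>)"
        using fin by (intro member_le_sum) (auto simp: Ls_def)
      then have "M m is \<le> 1 * \<gamma> m" by (simp add: \<gamma>_def)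
      also have "\<dots> \<le> N * \<gamma> m" using N1 \<gamma>1[of m] by (intro mult_right_mono) auto
      finally show ?thesis .
    qed
    then have le: "inverse (\<gamma> m) * M m is \<le> N" for m
      using \<gamma>1[of m] by (simp add: field_simps)
    have "cmod (partial_derivs is (cscale (complex_of_real (inverse (\<gamma> m))) \<phi>) x) \<le> N"
      if \<phi>: "\<phi> \<in> B m" for m \<phi> x
    proof -
      have "smooth_on UNIV \<phi>" using K(3) \<phi> by (auto simp: test_funs_in_def)
      then have "cmod (partial_derivs is (cscale (complex_of_real (inverse (\<gamma> m))) \<phi>) x)
          = inverse (\<gamma> m) * cmod (partial_derivs is \<phi> x)"
        using \<gamma>1[of m] by (simp add: partial_derivs_cscale norm_mult norm_inverse)
      also have "\<dots> \<le> inverse (\<gamma> m) * M m is"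
        using M[OF \<phi>] \<gamma>1[of m] by (intro mult_left_mono) auto
      finally show ?thesis using le[of m] by linarith
    qed
    then show "\<exists>N. \<forall>\<phi>\<in>?D. \<forall>x. cmod (partial_derivs is \<phi> x) \<le> N" by blast
  qed
  moreover have "0 < \<gamma> m" for m using \<gamma>1[of m] by linarith
  ultimately show ?thesis by blast
qed

section \<open>The transpose on test functions\<close>

text \<open>
  The data of the weighted composition operator, with \<open>Ct\<close> the transposed map on test functions and
  \<open>\<sigma>\<close> the smooth inverse of \<open>\<psi>\<close> on its image.
\<close>

locale weighted_map =
  fixes X :: "(real^'n) set" and w :: "real^'n \<Rightarrow> complex" and \<psi> :: "real^'n \<Rightarrow> real^'n"
  assumes X: "open X" and w: "smooth_on X w"
    and \<psi>: "smooth_on X \<psi>" "\<psi> ` X \<subseteq> X" "inj_on \<psi> X"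
      "\<forall>x\<in>X. det (jacobian \<psi> (at x)) \<noteq> 0"
begin

abbreviation "Ct \<equiv> weighted_comp_transpose X w \<psi>"
abbreviation "\<sigma> \<equiv> inv_into X \<psi>"

lemmas open_image = Ck_bounded_inverse_map(1)[OF X \<psi>(1,3,4)]
lemmas continuous_inverse = Ck_bounded_inverse_map(2)[OF X \<psi>(1,3,4)]
lemmas Ck_bounded_inv = Ck_bounded_inverse_map(3)[OF X \<psi>(1,3,4)]
lemmas continuous_\<psi> = smooth_on_continuous_on[OF \<psi>(1)]

lemma \<sigma>_\<psi> [simp]: "x \<in> X \<Longrightarrow> \<sigma> (\<psi> x) = x"
  using \<psi>(3) by simp

lemma Ct_at: "x \<in> X \<Longrightarrow> Ct \<phi> (\<psi> x) = \<phi> x * (w x * of_real (inverse \<bar>det (jacobian \<psi> (at x))\<bar>))"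
  by (simp add: weighted_comp_transpose_def divide_inverse)

lemma Ct_outside: "y \<notin> \<psi> ` X \<Longrightarrow> Ct \<phi> y = 0"
  by (simp add: weighted_comp_transpose_def)

text \<open>
  On the open set $\psi(X)$ the transpose multiplies by a fixed smooth function and then composes with
  $\sigma$; outside the compact set $\psi(K)$ it vanishes.
\<close>

lemma Ct_bounded_family:
  assumes K: "compact K" "K \<subseteq> X" and B: "B \<subseteq> test_funs_in K" "\<forall>k. Ck_bounded k UNIV B (\<lambda>\<phi>. \<phi>)"
  shows "Ct ` B \<subseteq> test_funs_in (\<psi> ` K) \<and> (\<forall>k. Ck_bounded k UNIV (Ct ` B) (\<lambda>\<phi>. \<phi>))"
proof -
  let ?g = "\<lambda>x. w x * complex_of_real (inverse \<bar>det (jacobian \<psi> (at x))\<bar>)"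
  have g: "smooth_on X ?g"
    by (intro smooth_on_mult smooth_on_of_real smooth_on_abs_det X w \<psi>)
  have cK: "closed (\<psi> ` K)"
    using K continuous_\<psi> by (intro compact_imp_closed compact_continuous_image) (auto intro: continuous_on_subset)
  have zero: "Ct \<phi> y = 0" if "\<phi> \<in> B" "y \<notin> \<psi> ` K" for \<phi> y
  proof (cases "y \<in> \<psi> ` X")
    case True
    then obtain x where x: "x \<in> X" "y = \<psi> x" by blast
    then have "x \<notin> supp \<phi>" using that B(1) by (auto simp: test_funs_in_def)
    then show ?thesis using x by (simp add: Ct_at notin_supp)
  qed (rule Ct_outside)
  have fam: "Ck_bounded k UNIV B Ct" for k
  proof (rule Ck_bounded_extend_zero[OF open_image cK _ zero])
    show "\<psi> ` K \<subseteq> \<psi> ` X" using K by auto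
    have prod: "Ck_bounded k X B (\<lambda>\<phi> x. \<phi> x * ?g x)"
      by (intro Ck_bounded_mult X smooth_on_imp_Ck_bounded[OF g]
          Ck_bounded_mono[OF B(2)[rule_format] subset_UNIV])
    have "Ck_bounded k (\<psi> ` X) B (\<lambda>\<phi> y. \<phi> (\<sigma> y) * ?g (\<sigma> y))"
      by (rule Ck_bounded_compose[OF open_image continuous_inverse _ Ck_bounded_inv prod])
        (auto intro: inv_into_into)
    then show "Ck_bounded k (\<psi> ` X) B Ct"
      by (rule Ck_bounded_cong[OF open_image, rotated]) (auto simp: Ct_at)
  qed
  then have "\<forall>k. Ck_bounded k UNIV (Ct ` B) (\<lambda>\<phi>. \<phi>)" by (simp add: Ck_bounded_image_iff)
  moreover from this have "smooth_on UNIV (Ct \<phi>)" if "\<phi> \<in> B" for \<phi>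
    using that unfolding all_Ck_bounded_iff by blast
  moreover have "supp (Ct \<phi>) \<subseteq> \<psi> ` K" if "\<phi> \<in> B" for \<phi>
    using zero that by (simp add: supp_subset_iff[OF cK])
  ultimately show ?thesis unfolding test_funs_in_def by blast
qed

lemma Ct_cscale: "Ct (cscale c \<phi>) = cscale c (Ct \<phi>)"
  by (auto simp: weighted_comp_transpose_def cscale_def fun_eq_iff Let_def)

lemma Ct_funpow_cscale: "(Ct ^^ m) (cscale c \<phi>) = cscale c ((Ct ^^ m) \<phi>)"
  by (induction m) (simp_all add: Ct_cscale)

lemma compact_image: "compact K \<Longrightarrow> K \<subseteq> X \<Longrightarrow> compact (\<psi> ` K) \<and> \<psi> ` K \<subseteq> X"
  using continuous_\<psi> \<psi>(2) by (auto intro!: compact_continuous_image intro: continuous_on_subset)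

lemma Ct_test_funs_in:
  assumes "compact K" "K \<subseteq> X" "\<phi> \<in> test_funs_in K"
  shows "Ct \<phi> \<in> test_funs_in (\<psi> ` K)"
proof -
  have "\<forall>k. Ck_bounded k UNIV {\<phi>} (\<lambda>\<phi>. \<phi>)"
    using assms(3) smooth_on_iff_Ck_bounded[OF open_UNIV, of \<phi>] by (simp add: test_funs_in_def)
  with Ct_bounded_family[OF assms(1,2), of "{\<phi>}"] assms(3) show ?thesis by simp
qed

lemma Ct_test_funs: "\<phi> \<in> test_funs X \<Longrightarrow> Ct \<phi> \<in> test_funs X"
  using Ct_test_funs_in compact_image test_funs_in_subset by (metis subsetD test_funsE)

lemma Ct_lc_bounded:
  assumes "lc_bounded (test_topology X) B"
  shows "lc_bounded (test_topology X) (Ct ` B)"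
  using assms Ct_bounded_family compact_image unfolding lc_bounded_test_topology_iff[OF X] by meson

lemma Ct_funpow_test_funs: "\<phi> \<in> test_funs X \<Longrightarrow> (Ct ^^ m) \<phi> \<in> test_funs X"
  by (induction m) (auto intro: Ct_test_funs)

lemma Ct_funpow_lc_bounded:
  "lc_bounded (test_topology X) B \<Longrightarrow> lc_bounded (test_topology X) ((Ct ^^ m) ` B)"
proof (induction m)
  case (Suc m)
  have "(Ct ^^ Suc m) ` B = Ct ` ((Ct ^^ m) ` B)" by (simp add: image_image)
  then show ?case using Suc Ct_lc_bounded by metis
qed simp

lemma funpow_image_subset: "U \<subseteq> X \<Longrightarrow> (\<psi> ^^ m) ` U \<subseteq> X"
  using \<psi>(2) by (induction m) auto

lemma image_funpow_Suc: "(\<psi> ^^ Suc m) ` U = \<psi> ` ((\<psi> ^^ m) ` U)"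
  by (simp add: image_image)

lemma open_funpow_image: "open U \<Longrightarrow> U \<subseteq> X \<Longrightarrow> open ((\<psi> ^^ m) ` U)"
proof (induction m)
  case (Suc m)
  have "open (\<psi> ` ((\<psi> ^^ m) ` U))"
    using Suc funpow_image_subset[OF Suc.prems(2), of m]
    by (intro invariance_of_domain[OF continuous_on_subset[OF continuous_\<psi>]
          _ inj_on_subset[OF \<psi>(3)]])
  then show ?case unfolding image_funpow_Suc .
qed simp

lemma continuous_on_funpow: "continuous_on X (\<psi> ^^ m)"
proof (induction m)
  case (Suc m)
  have "continuous_on X (\<psi> \<circ> (\<psi> ^^ m))"
    using Suc continuous_\<psi> funpow_image_subset[of X m]
    by (intro continuous_on_compose) (auto intro: continuous_on_subset)
  then show ?case by simp
qed (simp add: id_def)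

lemma compact_funpow_image:
  "compact K \<Longrightarrow> K \<subseteq> X \<Longrightarrow> compact ((\<psi> ^^ m) ` K) \<and> (\<psi> ^^ m) ` K \<subseteq> X"
  using funpow_image_subset[of K m]
  by (intro conjI compact_continuous_image continuous_on_subset[OF continuous_on_funpow]) auto

lemma Ct_funpow_test_funs_in:
  assumes "compact K" "K \<subseteq> X" "\<phi> \<in> test_funs_in K"
  shows "(Ct ^^ m) \<phi> \<in> test_funs_in ((\<psi> ^^ m) ` K)"
proof (induction m)
  case (Suc m)
  then have "Ct ((Ct ^^ m) \<phi>) \<in> test_funs_in (\<psi> ` ((\<psi> ^^ m) ` K))"
    using compact_funpow_image[OF assms(1,2)] by (intro Ct_test_funs_in) auto
  then show ?case unfolding image_funpow_Suc by simp
qed (use assms in simp)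

text \<open>
  Where the weight does not vanish, the transpose is inverted by
  $\theta\mapsto(\theta\circ\psi)\,|\det J\psi|/w$.
\<close>

lemma Ct_preimage:
  assumes U: "open U" "U \<subseteq> X" "\<And>x. x \<in> U \<Longrightarrow> w x \<noteq> 0" and \<theta>: "\<theta> \<in> test_funs (\<psi> ` U)"
  shows "\<exists>\<phi>\<in>test_funs U. Ct \<phi> = \<theta>"
proof
  define g where "g x = complex_of_real \<bar>det (jacobian \<psi> (at x))\<bar> * inverse (w x)" for x
  define \<phi> where "\<phi> x = (if x \<in> U then \<theta> (\<psi> x) * g x else 0)" for x
  define K where "K = \<sigma> ` supp \<theta>"
  have \<theta>': "smooth_on UNIV \<theta>" "compact (supp \<theta>)" "supp \<theta> \<subseteq> \<psi> ` U"
    using \<theta> by (auto simp: test_funs_def)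
  have K: "compact K" unfolding K_def
    using \<theta>' U(2)
    by (intro compact_continuous_image continuous_on_subset[OF continuous_inverse]) auto
  have KU: "K \<subseteq> U"
  proof
    fix x assume "x \<in> K"
    then obtain u where "u \<in> U" "x = \<sigma> (\<psi> u)" using \<theta>'(3) unfolding K_def by blast
    then show "x \<in> U" using U(2) by (simp add: subset_eq)
  qed
  have zero: "\<phi> x = 0" if "x \<notin> K" for x
  proof (cases "x \<in> U")
    case True
    then have "\<sigma> (\<psi> x) = x" using U(2) by auto
    then have "\<psi> x \<notin> supp \<theta>" using that by (metis K_def imageI)
    then show ?thesis by (simp add: \<phi>_def notin_supp)
  qed (simp add: \<phi>_def)
  have sub: "smooth_on U f" if "smooth_on X f" for f :: "real^'n \<Rightarrow> 'z::real_normed_vector"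
    using that U(2) by (auto simp: smooth_on_def)
  have "smooth_on U (\<lambda>x. inverse (w x))"
    by (rule smooth_on_Ck_boundedI, rule Ck_bounded_reciprocal[OF U(1) sub[OF w] U(3)])
  moreover have "smooth_on U (\<lambda>x. complex_of_real \<bar>det (jacobian \<psi> (at x))\<bar>)"
    by (rule smooth_on_of_real[OF U(1) sub[OF smooth_on_abs_det(1)[OF X \<psi>(1,4)]]])
  ultimately have g: "smooth_on U g" unfolding g_def by (intro smooth_on_mult U(1))
  have "Ck_bounded k U {()} (\<lambda>_ x. \<theta> (\<psi> x) * g x)" for k
  proof (intro Ck_bounded_mult U(1) smooth_on_imp_Ck_bounded[OF g])
    show "Ck_bounded k U {()} (\<lambda>_ x. \<theta> (\<psi> x))"
      by (rule Ck_bounded_compose[OF U(1) continuous_on_subset[OF continuous_\<psi> U(2)] subset_UNIV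
            smooth_on_imp_Ck_bounded[OF sub[OF \<psi>(1)]] smooth_on_imp_Ck_bounded[OF \<theta>'(1)]])
  qed
  then have "Ck_bounded k U {()} (\<lambda>_. \<phi>)" for k
    by (rule Ck_bounded_cong[OF U(1), rotated]) (simp add: \<phi>_def)
  then have "smooth_on UNIV \<phi>"
    by (intro smooth_on_Ck_boundedI Ck_bounded_extend_zero[OF U(1) compact_imp_closed[OF K] KU])
      (auto simp: zero)
  moreover have "supp \<phi> \<subseteq> K" using zero by (simp add: supp_subset_iff[OF compact_imp_closed[OF K]])
  ultimately show "\<phi> \<in> test_funs U"
    using test_funs_in_subset[OF K KU] by (auto simp: test_funs_in_def)
  show "Ct \<phi> = \<theta>"
  proof
    fix y
    show "Ct \<phi> y = \<theta> y"
    proof (cases "y \<in> \<psi> ` X")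
      case True
      then obtain x where x: "x \<in> X" "y = \<psi> x" by blast
      show ?thesis
      proof (cases "x \<in> U")
        case True
        then show ?thesis using x \<psi>(4) U(3) by (simp add: Ct_at \<phi>_def g_def field_simps)
      next
        case False
        then have "y \<notin> \<psi> ` U" using x U(2) \<psi>(3) by (auto simp: inj_on_def)
        then have "\<theta> y = 0" using \<theta>'(3) notin_supp[of y \<theta>] by blast
        then show ?thesis using False x by (simp add: Ct_at \<phi>_def)
      qed
    next
      case False
      then have "y \<notin> supp \<theta>" using \<theta>'(3) U(2) by auto
      then show ?thesis using False by (simp add: Ct_outside notin_supp)
    qed
  qed
qed

text \<open>
  The factor $w\circ\psi^l$ on $U$ is the weight $w$ on $\psi^l(U)$, so the transpose can be inverted one step
  at a time, from $\psi^m(U)$ down to $U$.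
\<close>

lemma Ct_funpow_preimage:
  assumes "open U" "U \<subseteq> X" "\<And>l x. l < m \<Longrightarrow> x \<in> U \<Longrightarrow> w ((\<psi> ^^ l) x) \<noteq> 0"
    and "\<theta> \<in> test_funs ((\<psi> ^^ m) ` U)"
  shows "\<exists>\<phi>\<in>test_funs U. (Ct ^^ m) \<phi> = \<theta>"
  using assms(3,4)
proof (induction m arbitrary: \<theta>)
  case (Suc m)
  obtain \<phi>' where \<phi>': "\<phi>' \<in> test_funs ((\<psi> ^^ m) ` U)" "Ct \<phi>' = \<theta>"
  proof -
    have "\<exists>\<phi>\<in>test_funs ((\<psi> ^^ m) ` U). Ct \<phi> = \<theta>"
      using Suc.prems assms(1,2)
      by (intro Ct_preimage open_funpow_image funpow_image_subset)
        (auto simp flip: image_funpow_Suc)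
    with that show ?thesis by blast
  qed
  have "\<exists>\<phi>\<in>test_funs U. (Ct ^^ m) \<phi> = \<phi>'"
    using Suc.prems(1) \<phi>'(1) by (intro Suc.IH) auto
  with \<phi>'(2) show ?case by auto
qed (use assms in auto)

section \<open>The operator and its powers on distributions\<close>

lemma weighted_comp_funpow:
  assumes "u \<in> distributions X"
  shows "(weighted_comp X w \<psi> ^^ m) u = (\<lambda>\<phi>. if \<phi> \<in> test_funs X then u ((Ct ^^ m) \<phi>) else 0)"
proof (induction m)
  case 0
  then show ?case using distributions_outside[OF assms] by (auto simp: fun_eq_iff)
next
  case (Suc m)
  have "(Ct ^^ m) (Ct \<phi>) = (Ct ^^ Suc m) \<phi>" for \<phi> by (simp add: funpow_swap1)
  then have "(weighted_comp X w \<psi> ^^ Suc m) u \<phi> =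
      (if \<phi> \<in> test_funs X then u ((Ct ^^ Suc m) \<phi>) else 0)" for \<phi>
    by (simp only: funpow.simps(2) o_apply Suc) (simp add: weighted_comp_def Ct_test_funs)
  then show ?case by (rule ext)
qed

lemma dual_sup_weighted_comp_funpow:
  assumes "u \<in> distributions X" "B \<subseteq> test_funs X"
  shows "dual_sup B ((weighted_comp X w \<psi> ^^ m) u) = dual_sup ((Ct ^^ m) ` B) u"
  unfolding dual_sup_def weighted_comp_funpow[OF assms(1)] image_image
  using assms(2) by (intro arg_cong[where f = Sup] image_cong) auto

text \<open>
  Each of the finitely many nonvanishing conditions is open and dense, so they can be imposed one
  after the other.
\<close>

lemma nonvanishing_dense:
  assumes c: "\<forall>l::nat. X \<subseteq> closure {x \<in> X. w ((\<psi> ^^ l) x) \<noteq> 0}"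
    and V: "open V" "V \<subseteq> X" "V \<noteq> {}"
  shows "open {x \<in> V. \<forall>l<m. w ((\<psi> ^^ l) x) \<noteq> 0} \<and> {x \<in> V. \<forall>l<m. w ((\<psi> ^^ l) x) \<noteq> 0} \<noteq> {}"
proof (induction m)
  case 0
  then show ?case using V by simp
next
  case (Suc m)
  let ?V = "{x \<in> V. \<forall>l<m. w ((\<psi> ^^ l) x) \<noteq> 0}"
  have eq: "{x \<in> V. \<forall>l<Suc m. w ((\<psi> ^^ l) x) \<noteq> 0} = {x \<in> ?V. w ((\<psi> ^^ m) x) \<noteq> 0}"
    by (auto simp: less_Suc_eq)
  have "continuous_on X (w \<circ> (\<psi> ^^ m))"
    using continuous_on_funpow funpow_image_subset[of X m] smooth_on_continuous_on[OF w]
    by (intro continuous_on_compose) (auto intro: continuous_on_subset)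
  then have "continuous_on ?V (\<lambda>x. w ((\<psi> ^^ m) x))"
    using V(2) by (auto simp: o_def intro: continuous_on_subset)
  then have "open (?V \<inter> (\<lambda>x. w ((\<psi> ^^ m) x)) -` (- {0}))"
    using Suc.IH by (intro continuous_open_preimage) auto
  moreover have "?V \<inter> (\<lambda>x. w ((\<psi> ^^ m) x)) -` (- {0}) = {x \<in> ?V. w ((\<psi> ^^ m) x) \<noteq> 0}" by auto
  moreover have "{x \<in> ?V. w ((\<psi> ^^ m) x) \<noteq> 0} \<noteq> {}"
  proof -
    obtain x where x: "x \<in> ?V" using Suc.IH by blast
    then have "x \<in> closure {x \<in> X. w ((\<psi> ^^ m) x) \<noteq> 0}" using c V(2) by blast
    then have "?V \<inter> {x \<in> X. w ((\<psi> ^^ m) x) \<noteq> 0} \<noteq> {}"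
      using x Suc.IH by (metis (no_types, lifting) IntI empty_iff open_Int_closure_eq_empty)
    then show ?thesis by blast
  qed
  ultimately show ?case unfolding eq by simp
qed

text \<open>
  Since $p_B(Cu-Cv)=p_{C^t B}(u-v)$, continuity follows from the boundedness of $C^t B$.
\<close>

lemma continuous_linear_weighted_comp:
  assumes G: "G X \<subseteq> distributions X" "cfun.subspace (G X)"
    and inv: "weighted_comp X w \<psi> ` G X \<subseteq> G X"
  shows "continuous_linear_operator (sheaf_topology G X) (weighted_comp X w \<psi>)"
proof -
  let ?C = "weighted_comp X w \<psi>" and ?T = "sheaf_topology G X"
  have ts: "topspace ?T = G X" using G(1) by (rule topspace_sheaf_topology)
  have diff: "?C u - ?C v = ?C (u - v)" for u v
    by (auto simp: weighted_comp_def fun_eq_iff)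
  have op: "openin ?T {u \<in> G X. dual_sup B (?C u - f) < e}"
    if B: "B \<noteq> {}" "lc_bounded (test_topology X) B" and f: "f \<in> distributions X" for B f e
  proof (subst openin_subopen, intro ballI)
    fix u assume "u \<in> {u \<in> G X. dual_sup B (?C u - f) < e}"
    then have u: "u \<in> G X" "dual_sup B (?C u - f) < e" by auto
    then have uD: "u \<in> distributions X" using G by auto
    have B': "Ct ` B \<noteq> {}" "lc_bounded (test_topology X) (Ct ` B)" using B Ct_lc_bounded by auto
    have BX: "B \<subseteq> test_funs X" using B(2) by (simp add: lc_bounded_def test_topology_eq)
    define V where "V = {v \<in> distributions X. dual_sup (Ct ` B) (v - u) < e - dual_sup B (?C u - f)} \<inter> G X"
    have "openin ?T V"
      unfolding V_def using B' u uD by (intro openin_sheaf_topology_dual_ball) auto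
    moreover have "u \<in> V"
    proof -
      have "dual_sup (Ct ` B) (u - u) = 0"
        unfolding diff_self
        by (rule seminorm_on_zero[OF subspace_distributions seminorm_on_dual_sup[OF B']])
      then have "dual_sup (Ct ` B) (u - u) < e - dual_sup B (?C u - f)" using u(2) by linarith
      then show ?thesis unfolding V_def using u(1) uD by blast
    qed
    moreover have "V \<subseteq> {u \<in> G X. dual_sup B (?C u - f) < e}"
    proof
      fix v assume "v \<in> V"
      then have v: "v \<in> G X" "dual_sup (Ct ` B) (v - u) < e - dual_sup B (?C u - f)"
        unfolding V_def by auto
      have CD: "?C v \<in> distributions X" "?C u \<in> distributions X" using inv G u v by blast+
      have vu: "v - u \<in> distributions X"
        using v(1) G(1) uD by (intro cfun.subspace_diff[OF subspace_distributions]) auto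
      have "dual_sup B (?C v - f) \<le> dual_sup B ((?C v - f) - (?C u - f)) + dual_sup B (?C u - f)"
        by (rule seminorm_on_diff_triangle[OF subspace_distributions seminorm_on_dual_sup[OF B]])
          (use CD f in \<open>auto intro: cfun.subspace_diff[OF subspace_distributions]\<close>)
      also have "(?C v - f) - (?C u - f) = ?C (v - u)" using diff[of v u] by (simp only: diff_diff_eq2 diff_add_cancel diff)
      also have "dual_sup B (?C (v - u)) = dual_sup (Ct ` B) (v - u)"
        using dual_sup_weighted_comp_funpow[OF vu BX, of 1] by simp
      finally have "dual_sup B (?C v - f) < e" using v(2) by linarith
      then show "v \<in> {u \<in> G X. dual_sup B (?C u - f) < e}" using v(1) by blast
    qed
    ultimately show "\<exists>S. openin ?T S \<and> u \<in> S \<and> S \<subseteq> {u \<in> G X. dual_sup B (?C u - f) < e}" by blast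
  qed
  have "continuous_map ?T (strong_topology X) ?C"
    unfolding strong_topology_eq lc_topology_def continuous_on_generated_topo_iff ts
  proof (intro conjI allI impI)
    fix S assume "S \<in> insert (distributions X) {{g \<in> distributions X. p (g - f) < e} |p f e.
        p \<in> strong_seminorms X \<and> f \<in> distributions X \<and> 0 < e}"
    then consider "S = distributions X"
      | p f e where "S = {g \<in> distributions X. p (g - f) < e}" "p \<in> strong_seminorms X" "f \<in> distributions X"
      by blast
    then show "openin ?T (?C -` S \<inter> G X)"
    proof cases
      case 1
      then have "?C -` S \<inter> G X = topspace ?T" using inv G(1) ts by auto
      then show ?thesis by simp
    next
      case 2
      then obtain B where B: "p = dual_sup B" "B \<noteq> {}" "lc_bounded (test_topology X) B"
        by (auto simp: strong_seminorms_def)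
      have "?C -` S \<inter> G X = {u \<in> G X. dual_sup B (?C u - f) < e}"
        unfolding 2(1) B(1) using inv G(1) by blast
      then show ?thesis using op[OF B(2,3) 2(3)] by simp
    qed
  qed (use inv G in blast)
  then have "continuous_map ?T (subtopology (strong_topology X) (G X)) ?C"
    by (rule continuous_map_into_subtopology) (use inv ts in auto)
  then have "continuous_map ?T ?T ?C" by (simp only: sheaf_topology_def)
  then show ?thesis
    by (auto simp: continuous_linear_operator_def weighted_comp_def cscale_def fun_eq_iff)
qed

end

section \<open>Separation by gluing and approximation\<close>

lemma exhaustion_compact:
  assumes "rel_compact_exhaustion X Xs" "compact Q" "Q \<subseteq> X"
  shows "\<exists>n. Q \<subseteq> Xs n"
proof -
  have op: "open (Xs n)" and step: "Xs n \<subseteq> Xs (Suc n)" for n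
    using assms(1) closure_subset[of "Xs n"] by (auto simp: rel_compact_exhaustion_def)
  have mono: "Xs m \<subseteq> Xs n" if "m \<le> n" for m n
    using lift_Suc_mono_le[of Xs, OF step that] .
  have "Q \<subseteq> (\<Union>n\<in>UNIV. Xs n)" using assms by (simp add: rel_compact_exhaustion_def)
  then obtain N where N: "finite N" "Q \<subseteq> (\<Union>n\<in>N. Xs n)"
    using compactE_image[OF assms(2), of UNIV Xs] op by metis
  have "Xs n \<subseteq> Xs (Max (insert 0 N))" if "n \<in> N" for n
    using N(1) that by (intro mono) auto
  with N(2) show ?thesis by blast
qed

lemma exhaustion_properties:
  assumes "rel_compact_exhaustion X Xs"
  shows "open (Xs n)" "compact (closure (Xs n))" "closure (Xs n) \<subseteq> X" "Xs n \<subseteq> X"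
proof -
  have "Xs (Suc n) \<subseteq> X" using assms by (auto simp: rel_compact_exhaustion_def)
  then show "open (Xs n)" "compact (closure (Xs n))" "closure (Xs n) \<subseteq> X" "Xs n \<subseteq> X"
    using assms closure_subset[of "Xs n"] by (fastforce simp: rel_compact_exhaustion_def)+
qed

lemma test_funs_translate:
  assumes "\<eta> \<in> test_funs (ball 0 \<epsilon>)"
  shows "(\<lambda>y. \<eta> (y - x)) \<in> test_funs (ball x \<epsilon>)"
proof -
  have \<eta>: "smooth_on UNIV \<eta>" "compact (supp \<eta>)" "supp \<eta> \<subseteq> ball 0 \<epsilon>"
    using assms by (auto simp: test_funs_def)
  let ?K = "(\<lambda>y. x + y) ` supp \<eta>"
  have K: "compact ?K" using \<eta>(2) by (intro compact_continuous_image continuous_intros)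
  have KB: "?K \<subseteq> ball x \<epsilon>" using \<eta>(3) by (auto simp: dist_norm)
  have "smooth_on UNIV (\<lambda>y. \<eta> (y - x))"
  proof (rule smooth_on_Ck_boundedI)
    show "Ck_bounded k UNIV {()} (\<lambda>_ y. \<eta> (y - x))" for k
      by (rule Ck_bounded_compose[OF open_UNIV _ subset_UNIV
            smooth_on_imp_Ck_bounded[OF smooth_on_translation] smooth_on_imp_Ck_bounded[OF \<eta>(1)]])
        (intro continuous_intros)
  qed
  moreover have "supp (\<lambda>y. \<eta> (y - x)) \<subseteq> ?K"
    unfolding supp_subset_iff[OF compact_imp_closed[OF K]]
  proof (intro allI impI)
    fix y assume "y \<notin> ?K"
    then have "y - x \<notin> supp \<eta>" by (metis add_diff_cancel_left' diff_add_cancel add.commute imageI)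
    then show "\<eta> (y - x) = 0" by (rule notin_supp)
  qed
  ultimately show ?thesis using test_funs_in_subset[OF K KB] by (auto simp: test_funs_in_def)
qed

lemma zero_of_test_funs_empty: "\<phi> \<in> test_funs {} \<Longrightarrow> \<phi> = 0"
  by (auto simp: test_funs_def fun_eq_iff intro: notin_supp)

lemma distribution_zero: "u \<in> distributions X \<Longrightarrow> u 0 = 0"
  using distributions_cscale[of u X 0 0] cfun.subspace_0[OF subspace_test_funs, of X]
  by (simp add: cscale_def zero_fun_def)

lemma sheaf_subset: "distribution_sheaf G \<Longrightarrow> open X \<Longrightarrow> G X \<subseteq> distributions X"
  and sheaf_subspace: "distribution_sheaf G \<Longrightarrow> open X \<Longrightarrow> cfun.subspace (G X)"
  by (auto simp: distribution_sheaf_def)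

text \<open>
  Over disjoint open sets the compatibility condition only concerns the zero test function.
\<close>

lemma glue_disjoint:
  assumes G: "distribution_sheaf G" and UV: "open U" "open V" "U \<inter> V = {}"
    and h: "h \<in> G V"
  obtains v where "v \<in> G (U \<union> V)" "\<And>\<phi>. \<phi> \<in> test_funs U \<Longrightarrow> v \<phi> = 0"
    "\<And>\<phi>. \<phi> \<in> test_funs V \<Longrightarrow> v \<phi> = h \<phi>"
proof -
  define S where "S b = (if b then U else V)" for b
  define u where "u b = (if b then 0 else h)" for b
  have 0: "0 \<in> G U" using sheaf_subspace[OF G UV(1)] by (rule cfun.subspace_0)
  have uD: "u b \<in> distributions (S b)" for b
    using sheaf_subset[OF G UV(1)] sheaf_subset[OF G UV(2)] 0 h by (auto simp: u_def S_def)
  have compat: "restr (S i \<inter> S j) (u i) = restr (S i \<inter> S j) (u j)" for i j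
  proof (cases "i = j")
    case False
    then have "S i \<inter> S j = {}" using UV(3) by (auto simp: S_def)
    moreover have "u i \<phi> = u j \<phi>" if "\<phi> \<in> test_funs {}" for \<phi>
      using zero_of_test_funs_empty[OF that] distribution_zero[OF uD] by metis
    ultimately show ?thesis unfolding restr_def by auto
  qed simp
  have S: "open (S i)" "u i \<in> G (S i)" for i using UV 0 h by (auto simp: S_def u_def)
  have "(\<Union>i\<in>UNIV. S i) = U \<union> V" by (auto simp: S_def)
  then have "\<exists>v\<in>G (U \<union> V). \<forall>i\<in>UNIV. restr (S i) v = u i"
    using UV by (intro distribution_sheaf_gluing[OF G] S compat) auto
  then obtain v where v: "v \<in> G (U \<union> V)" "\<And>i. restr (S i) v = u i" by blast
  have "v \<phi> = 0" if "\<phi> \<in> test_funs U" for \<phi>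
    using fun_cong[OF v(2)[of True], of \<phi>] that by (simp add: restr_def S_def u_def)
  moreover have "v \<phi> = h \<phi>" if "\<phi> \<in> test_funs V" for \<phi>
    using fun_cong[OF v(2)[of False], of \<phi>] that by (simp add: restr_def S_def u_def)
  ultimately show ?thesis using v(1) that by blast
qed

text \<open>
  The section that vanishes on $U$ and equals $h$ on $V$ is approximated by global sections uniformly
  on the bounded set $B\cup\{\theta\}$. For such a $u$ the seminorm over $B$ is small while $u(\theta)$ stays near
  $h(\theta)\ne 0$.
\<close>

lemma sheaf_separation:
  assumes G: "distribution_sheaf G" and X: "open X"
    and UV: "open U" "open V" "U \<inter> V = {}" "U \<union> V \<subseteq> X"
    and dense: "sheaf_topology G (U \<union> V) closure_of (restr (U \<union> V) ` G X) = G (U \<union> V)"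
    and h: "h \<in> G V" "\<theta> \<in> test_funs V" "h \<theta> \<noteq> 0"
    and B: "B \<noteq> {}" "lc_bounded (test_topology X) B" "compact L" "L \<subseteq> U" "B \<subseteq> test_funs_in L"
  shows "\<not> (\<forall>u\<in>G X. cmod (u \<theta>) \<le> c * dual_sup B u)"
proof
  assume bound: "\<forall>u\<in>G X. cmod (u \<theta>) \<le> c * dual_sup B u"
  let ?Y = "U \<union> V"
  have Y: "open ?Y" using UV by auto
  obtain v where v: "v \<in> G ?Y" "\<And>\<phi>. \<phi> \<in> test_funs U \<Longrightarrow> v \<phi> = 0" "v \<theta> = h \<theta>"
    using glue_disjoint[OF G UV(1-3) h(1)] h(2) by metis
  have vD: "v \<in> distributions ?Y" using v(1) sheaf_subset[OF G Y] by auto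
  have BU: "B \<subseteq> test_funs U" using B test_funs_in_subset by blast
  have sub: "test_funs U \<subseteq> test_funs ?Y" "test_funs V \<subseteq> test_funs ?Y"
    by (auto simp: test_funs_def)
  define B' where "B' = insert \<theta> B"
  have "lc_bounded (test_topology ?Y) B"
    using B UV unfolding lc_bounded_test_topology_iff[OF Y] lc_bounded_test_topology_iff[OF X]
    by (intro exI[of _ L]) auto
  moreover have "lc_bounded (test_topology ?Y) {\<theta>}"
    using h(2) sub by (intro lc_bounded_singleton) (auto simp: test_topology_eq)
  ultimately have B': "B' \<noteq> {}" "lc_bounded (test_topology ?Y) B'"
    using lc_bounded_Un[of _ "{\<theta>}" B] by (auto simp: B'_def)
  \<comment> \<open>Chosen such that the assumed bound gives \<open>cmod (u \<theta>) + \<delta> \<le> cmod (h \<theta>)\<close>, whereas approximation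
    within \<open>\<delta>\<close> gives the strict opposite.\<close>
  define \<delta> where "\<delta> = cmod (h \<theta>) / (\<bar>c\<bar> + 1)"
  have \<delta>: "0 < \<delta>" using h(3) by (simp add: \<delta>_def)
  let ?N = "{g \<in> distributions ?Y. dual_sup B' (g - v) < \<delta>} \<inter> G ?Y"
  have N: "openin (sheaf_topology G ?Y) ?N"
    using vD B' \<delta> by (rule openin_sheaf_topology_dual_ball)
  have vN: "v \<in> ?N"
  proof -
    have "dual_sup B' (v - v) = 0" unfolding diff_self
      by (rule seminorm_on_zero[OF subspace_distributions seminorm_on_dual_sup[OF B']])
    then have "dual_sup B' (v - v) < \<delta>" using \<delta> by linarith
    then show ?thesis using v vD by blast
  qed
  have "v \<in> sheaf_topology G ?Y closure_of (restr ?Y ` G X)" using v(1) dense by simp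
  then have "\<exists>g. g \<in> restr ?Y ` G X \<and> g \<in> ?N"
    using N vN unfolding in_closure_of by (elim conjE allE[of _ ?N] impE) (rule conjI)
  then obtain g where "g \<in> restr ?Y ` G X" "g \<in> ?N" by (elim exE conjE)
  then obtain u where u: "u \<in> G X" "restr ?Y u \<in> distributions ?Y" "dual_sup B' (restr ?Y u - v) < \<delta>"
    by blast
  have rv: "restr ?Y u - v \<in> distributions ?Y"
    by (rule cfun.subspace_diff[OF subspace_distributions u(2) vD])
  have close: "cmod (u \<phi> - v \<phi>) < \<delta>" if "\<phi> \<in> B'" for \<phi>
  proof -
    have "\<phi> \<in> test_funs ?Y" using that h(2) BU sub by (auto simp: B'_def)
    then have "(restr ?Y u - v) \<phi> = u \<phi> - v \<phi>" by (simp add: restr_def)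
    with dual_sup_upper[OF rv B'(2) that] u(3) show ?thesis by simp
  qed
  have "dual_sup B u \<le> \<delta>"
  proof (rule dual_sup_least[OF B(1)])
    show "cmod (u \<phi>) \<le> \<delta>" if "\<phi> \<in> B" for \<phi>
      using close[of \<phi>] v(2)[of \<phi>] BU that by (auto simp: B'_def)
  qed
  moreover have "0 \<le> dual_sup B u"
    using seminorm_on_nonneg[OF seminorm_on_dual_sup[OF B(1,2)]] u(1) sheaf_subset[OF G X] by auto
  ultimately have "c * dual_sup B u \<le> \<bar>c\<bar> * \<delta>"
    by (intro mult_mono) auto
  then have "cmod (u \<theta>) \<le> \<bar>c\<bar> * \<delta>" using bound u(1) by (meson order_trans)
  moreover have "cmod (h \<theta>) < cmod (u \<theta>) + \<delta>"
    using close[of \<theta>] v(3) norm_triangle_ineq3[of "h \<theta>" "u \<theta>"]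
    by (simp add: B'_def norm_minus_commute)
  moreover have "\<bar>c\<bar> * \<delta> + \<delta> = cmod (h \<theta>)"
  proof -
    have "\<bar>c\<bar> * \<delta> + \<delta> = \<delta> * (\<bar>c\<bar> + 1)" by (simp add: algebra_simps)
    also have "\<dots> = cmod (h \<theta>)" unfolding \<delta>_def by (rule nonzero_eq_divide_eq[THEN iffD1]) auto
    finally show ?thesis .
  qed
  ultimately show False by linarith
qed

section \<open>Topologizability and stable orbits\<close>

context weighted_map
begin

text \<open>
  A single seminorm works for all powers because, by stability, the images of \<open>B\<close> under all powers of
  the transpose are carried by one compact set and so can be rescaled into one bounded set.
\<close>

lemma stable_imp_topologizable:
  assumes G: "distribution_sheaf G"
    and inv: "weighted_comp X w \<psi> ` G X \<subseteq> G X" and stable: "stable_orbits X \<psi>"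
  shows "topologizable (sheaf_topology G X) (weighted_comp X w \<psi>)"
  unfolding topologizable_def
proof (intro conjI allI impI)
  note GX = sheaf_subset[OF G X] sheaf_subspace[OF G X]
  let ?C = "weighted_comp X w \<psi>"
  show "continuous_linear_operator (sheaf_topology G X) ?C"
    by (rule continuous_linear_weighted_comp[of G, OF GX inv])
  have C_in: "(?C ^^ m) u \<in> G X" if "u \<in> G X" for u m
    using inv that by (induction m) auto
  fix p assume "continuous_seminorm (sheaf_topology G X) p"
  then obtain B C where B: "B \<noteq> {}" "lc_bounded (test_topology X) B" "0 < C"
    "\<And>u. u \<in> G X \<Longrightarrow> p u \<le> C * dual_sup B u"
    using continuous_seminorm_sheaf_bound[of G X, OF GX] by metis
  obtain K where K: "compact K" "K \<subseteq> X" "B \<subseteq> test_funs_in K"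
    using lc_bounded_common_support[OF X B(2)] by blast
  have "\<exists>L. compact L \<and> L \<subseteq> X \<and> (\<forall>m\<ge>1. (\<psi> ^^ m) ` K \<subseteq> L)"
    using stable K(1,2) by (simp add: stable_orbits_def)
  then obtain L where L: "compact L" "L \<subseteq> X" "\<forall>m\<ge>1. (\<psi> ^^ m) ` K \<subseteq> L"
    by (elim exE conjE)
  \<comment> \<open>Stability only concerns the iterates from the first on, hence the shift of the index.\<close>
  define Bs where "Bs m = (Ct ^^ Suc m) ` B" for m
  have "Bs m \<subseteq> test_funs_in L" for m
  proof -
    have "Bs m \<subseteq> test_funs_in ((\<psi> ^^ Suc m) ` K)"
      unfolding Bs_def using Ct_funpow_test_funs_in[OF K(1,2), of _ "Suc m"] K(3) by blast
    also have "\<dots> \<subseteq> test_funs_in L" using L(3)[rule_format, of "Suc m"] unfolding test_funs_in_def by fastforce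
    finally show ?thesis .
  qed
  moreover have "lc_bounded (test_topology X) (Bs m)" for m
    unfolding Bs_def by (rule Ct_funpow_lc_bounded[OF B(2)])
  ultimately obtain \<gamma> where \<gamma>: "\<And>m. 0 < \<gamma> m"
    and bd: "lc_bounded (test_topology X) (\<Union>m. cscale (complex_of_real (inverse (\<gamma> m))) ` Bs m)"
    using rescaling_of_bounded_sets[OF L(1,2) _ X, of Bs] by blast
  define D where "D = (\<Union>m. cscale (complex_of_real (inverse (\<gamma> m))) ` Bs m)"
  have D: "D \<noteq> {}" "lc_bounded (test_topology X) D" using B(1) bd by (auto simp: D_def Bs_def)
  have BX: "B \<subseteq> test_funs X" using K test_funs_in_subset by blast
  have "p ((?C ^^ Suc m) u) \<le> C * \<gamma> m * dual_sup D u" if u: "u \<in> G X" for m u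
  proof -
    have uD: "u \<in> distributions X" using u GX by auto
    have "dual_sup (Bs m) u \<le> \<gamma> m * dual_sup D u"
    proof (rule dual_sup_least)
      show "Bs m \<noteq> {}" using B(1) by (simp add: Bs_def)
      fix \<phi> assume \<phi>: "\<phi> \<in> Bs m"
      then have "\<phi> \<in> test_funs X" using Ct_funpow_test_funs BX unfolding Bs_def by blast
      then have "cmod (u (cscale (complex_of_real (inverse (\<gamma> m))) \<phi>)) = inverse (\<gamma> m) * cmod (u \<phi>)"
        using distributions_cscale[OF uD] \<gamma>[of m] by (simp add: norm_mult norm_inverse)
      moreover have "cscale (complex_of_real (inverse (\<gamma> m))) \<phi> \<in> D" using \<phi> by (auto simp: D_def)
      ultimately have "inverse (\<gamma> m) * cmod (u \<phi>) \<le> dual_sup D u"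
        using dual_sup_upper[OF uD D(2)] by metis
      then show "cmod (u \<phi>) \<le> \<gamma> m * dual_sup D u" using \<gamma>[of m] by (simp add: field_simps)
    qed
    then have "C * dual_sup (Bs m) u \<le> C * (\<gamma> m * dual_sup D u)"
      using B(3) by (intro mult_left_mono) auto
    moreover have "dual_sup B ((?C ^^ Suc m) u) = dual_sup (Bs m) u"
      unfolding Bs_def by (rule dual_sup_weighted_comp_funpow[OF uD BX])
    ultimately show ?thesis using B(4)[OF C_in[OF u, of "Suc m"]] by (simp only: mult.assoc)
  qed
  moreover have "0 < C * \<gamma> m" for m using B(3) \<gamma> by simp
  ultimately have "\<exists>c>0. \<forall>u\<in>G X. p ((?C ^^ m) u) \<le> c * dual_sup D u" if "m \<ge> 1" for m
    using that by (metis Suc_diff_1 less_eq_Suc_le One_nat_def)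
  moreover have "continuous_seminorm (sheaf_topology G X) (dual_sup D)"
    by (rule continuous_seminorm_dual_sup[of G X, OF GX D])
  ultimately show "\<exists>q. continuous_seminorm (sheaf_topology G X) q \<and> (\<forall>m\<ge>1. \<exists>\<gamma>>0.
      \<forall>u\<in>topspace (sheaf_topology G X). p ((?C ^^ m) u) \<le> \<gamma> * q u)"
    unfolding topspace_sheaf_topology[of G X, OF GX(1)] by blast
qed

text \<open>
  The ball around \<open>y\<close> is taken inside the image under $\psi^m$ of an open set on which
  $w, w\circ\psi,\dots,w\circ\psi^{m-1}$ do not vanish, which is what inverting the $m$-th power of the transpose
  on test functions of that ball requires. All the $\varphi$ obtained for different $m$ and $k$ are supported in
  the same compact set, the closure of $X_n$.
\<close>

lemma escaping_test_fun:
  assumes ex: "rel_compact_exhaustion X Xs"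
    and b: "\<exists>\<epsilon>\<^sub>0>0. \<forall>\<epsilon>. 0 < \<epsilon> \<and> \<epsilon> < \<epsilon>\<^sub>0 \<longrightarrow>
      (\<exists>\<eta> \<in> test_funs (ball 0 \<epsilon>). \<forall>x\<in>X. closure (ball x \<epsilon>) \<subseteq> X \<longrightarrow>
         (\<exists>h \<in> G (ball x \<epsilon>). h (\<lambda>y. \<eta> (y - x)) \<noteq> 0))"
    and c: "\<forall>l::nat. X \<subseteq> closure {x \<in> X. w ((\<psi> ^^ l) x) \<noteq> 0}"
    and x: "x \<in> Xs n" "(\<psi> ^^ m) x \<notin> closure (Xs k)"
  shows "\<exists>y \<epsilon> h \<theta> \<phi>. 0 < \<epsilon> \<and> y \<in> X - closure (Xs k) \<and> closure (ball y \<epsilon>) \<subseteq> X - Xs k \<and>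
    h \<in> G (ball y \<epsilon>) \<and> \<theta> \<in> test_funs (ball y \<epsilon>) \<and> h \<theta> \<noteq> 0 \<and>
    \<phi> \<in> test_funs_in (closure (Xs n)) \<and> (Ct ^^ m) \<phi> = \<theta>"
proof -
  note Xs = exhaustion_properties[OF ex]
  define V where "V = Xs n \<inter> (\<psi> ^^ m) -` (- closure (Xs k))"
  have V: "open V" "V \<subseteq> X" "V \<noteq> {}"
  proof -
    show "open V" unfolding V_def
      by (intro continuous_open_preimage continuous_on_subset[OF continuous_on_funpow Xs(4)] Xs(1)) auto
    show "V \<subseteq> X" "V \<noteq> {}" using Xs(4)[of n] x by (auto simp: V_def)
  qed
  define U where "U = {x \<in> V. \<forall>l<m. w ((\<psi> ^^ l) x) \<noteq> 0}"
  have U: "open U" "U \<noteq> {}" "U \<subseteq> X" using nonvanishing_dense[OF c V, of m] V(2) by (auto simp: U_def)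
  then obtain y where y: "y \<in> (\<psi> ^^ m) ` U" by blast
  obtain r where r: "0 < r" "ball y r \<subseteq> (\<psi> ^^ m) ` U"
    using open_funpow_image[OF U(1,3)] y open_contains_ball by metis
  obtain \<epsilon>0 where \<epsilon>0: "0 < \<epsilon>0" "\<And>\<epsilon>. 0 < \<epsilon> \<Longrightarrow> \<epsilon> < \<epsilon>0 \<Longrightarrow>
      (\<exists>\<eta> \<in> test_funs (ball 0 \<epsilon>). \<forall>x\<in>X. closure (ball x \<epsilon>) \<subseteq> X \<longrightarrow>
         (\<exists>h \<in> G (ball x \<epsilon>). h (\<lambda>y. \<eta> (y - x)) \<noteq> 0))" using b by blast
  define \<epsilon> where "\<epsilon> = min r \<epsilon>0 / 2"
  have \<epsilon>: "0 < \<epsilon>" "\<epsilon> < \<epsilon>0" "\<epsilon> < r" using r(1) \<epsilon>0(1) by (auto simp: \<epsilon>_def)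
  have "closure (ball y \<epsilon>) \<subseteq> ball y r" using \<epsilon> by (auto simp: subset_eq)
  then have cl: "closure (ball y \<epsilon>) \<subseteq> (\<psi> ^^ m) ` U" using r(2) by blast
  have img: "(\<psi> ^^ m) ` U \<subseteq> X - closure (Xs k)"
    using funpow_image_subset[OF U(3)] by (auto simp: U_def V_def)
  obtain \<eta> where \<eta>: "\<eta> \<in> test_funs (ball 0 \<epsilon>)" "\<forall>x\<in>X. closure (ball x \<epsilon>) \<subseteq> X \<longrightarrow>
         (\<exists>h \<in> G (ball x \<epsilon>). h (\<lambda>y. \<eta> (y - x)) \<noteq> 0)" using \<epsilon>0(2)[OF \<epsilon>(1,2)] by blast
  have "y \<in> X" "closure (ball y \<epsilon>) \<subseteq> X" using y cl img by blast+
  with \<eta>(2) obtain h where h: "h \<in> G (ball y \<epsilon>)" "h (\<lambda>z. \<eta> (z - y)) \<noteq> 0" by blast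
  have \<theta>: "(\<lambda>z. \<eta> (z - y)) \<in> test_funs (ball y \<epsilon>)" by (rule test_funs_translate[OF \<eta>(1)])
  have "ball y \<epsilon> \<subseteq> (\<psi> ^^ m) ` U" using cl closure_subset by blast
  then have "(\<lambda>z. \<eta> (z - y)) \<in> test_funs ((\<psi> ^^ m) ` U)" using \<theta> by (auto simp: test_funs_def)
  then have "\<exists>\<phi>\<in>test_funs U. (Ct ^^ m) \<phi> = (\<lambda>z. \<eta> (z - y))"
    using U by (intro Ct_funpow_preimage) (auto simp: U_def)
  then obtain \<phi> where \<phi>: "\<phi> \<in> test_funs U" "(Ct ^^ m) \<phi> = (\<lambda>z. \<eta> (z - y))" by blast
  have "U \<subseteq> closure (Xs n)" using closure_subset by (auto simp: U_def V_def)
  then have "\<phi> \<in> test_funs_in (closure (Xs n))"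
    using \<phi>(1) by (auto simp: test_funs_def test_funs_in_def)
  moreover have "y \<in> X - closure (Xs k)" "closure (ball y \<epsilon>) \<subseteq> X - Xs k"
    using y cl img closure_subset[of "Xs k"] by blast+
  ultimately show ?thesis using \<epsilon>(1) h \<theta> \<phi>(2) by blast
qed

text \<open>
  The bounded set \<open>B\<close> collects one escaping test function for every member of the exhaustion, before
  the bounded set \<open>B'\<close> that controls all powers is known; whichever $X_k$ then contains the supports of
  \<open>B'\<close>, the \<open>k\<close>-th test function in \<open>B\<close> contradicts the estimate.
\<close>

lemma topologizable_imp_stable:
  assumes G: "distribution_sheaf G"
    and ex: "rel_compact_exhaustion X Xs"
    and a: "\<forall>n. \<forall>x \<in> X - closure (Xs n). \<forall>\<epsilon>>0. closure (ball x \<epsilon>) \<subseteq> X - Xs n \<longrightarrow>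
         sheaf_topology G (Xs n \<union> ball x \<epsilon>) closure_of (restr (Xs n \<union> ball x \<epsilon>) ` G X)
           = G (Xs n \<union> ball x \<epsilon>)"
    and b: "\<exists>\<epsilon>\<^sub>0>0. \<forall>\<epsilon>. 0 < \<epsilon> \<and> \<epsilon> < \<epsilon>\<^sub>0 \<longrightarrow>
      (\<exists>\<eta> \<in> test_funs (ball 0 \<epsilon>). \<forall>x\<in>X. closure (ball x \<epsilon>) \<subseteq> X \<longrightarrow>
         (\<exists>h \<in> G (ball x \<epsilon>). h (\<lambda>y. \<eta> (y - x)) \<noteq> 0))"
    and c: "\<forall>l::nat. X \<subseteq> closure {x \<in> X. w ((\<psi> ^^ l) x) \<noteq> 0}"
    and top: "topologizable (sheaf_topology G X) (weighted_comp X w \<psi>)"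
  shows "stable_orbits X \<psi>"
proof (rule ccontr)
  note GX = sheaf_subset[OF G X] sheaf_subspace[OF G X]
  note Xs = exhaustion_properties[OF ex]
  let ?C = "weighted_comp X w \<psi>"
  assume "\<not> stable_orbits X \<psi>"
  then obtain K where K: "compact K" "K \<subseteq> X"
    "\<not> (\<exists>L. compact L \<and> L \<subseteq> X \<and> (\<forall>m\<ge>1. (\<psi> ^^ m) ` K \<subseteq> L))"
    unfolding stable_orbits_def not_all not_imp by (elim exE conjE)
  obtain n where n: "K \<subseteq> Xs n" using exhaustion_compact[OF ex K(1,2)] by blast
  define Q where "Q k m y \<epsilon> h \<theta> \<phi> \<longleftrightarrow> m \<ge> 1 \<and> 0 < \<epsilon> \<and> y \<in> X - closure (Xs k) \<and>
    closure (ball y \<epsilon>) \<subseteq> X - Xs k \<and>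
    h \<in> G (ball y \<epsilon>) \<and> \<theta> \<in> test_funs (ball y \<epsilon>) \<and> h \<theta> \<noteq> 0 \<and>
    \<phi> \<in> test_funs_in (closure (Xs n)) \<and> (Ct ^^ m) \<phi> = \<theta>" for k m y \<epsilon> h \<theta> \<phi>
  have "\<exists>m y \<epsilon> h \<theta> \<phi>. Q k m y \<epsilon> h \<theta> \<phi>" for k
  proof -
    obtain m where m: "m \<ge> 1" "\<not> (\<psi> ^^ m) ` K \<subseteq> closure (Xs k)"
      using K(3) Xs(2)[of k] Xs(3)[of k] by meson
    then obtain x where "x \<in> Xs n" "(\<psi> ^^ m) x \<notin> closure (Xs k)" using n by blast
    from escaping_test_fun[OF ex b c this] m(1) show ?thesis unfolding Q_def by blast
  qed
  then obtain m y \<epsilon> h \<theta> \<phi> where Q: "\<And>k. Q k (m k) (y k) (\<epsilon> k) (h k) (\<theta> k) (\<phi> k)" by metis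
  have \<phi>: "\<phi> k \<in> test_funs_in (closure (Xs n))" for k using Q[of k] by (simp add: Q_def)
  have \<phi>X: "\<phi> k \<in> test_funs X" for k using \<phi>[of k] test_funs_in_subset[OF Xs(2,3)] by blast
  obtain \<gamma> where \<gamma>: "\<And>k. 0 < \<gamma> k"
    and bd: "lc_bounded (test_topology X) (\<Union>k. cscale (complex_of_real (inverse (\<gamma> k))) ` {\<phi> k})"
  proof -
    have "lc_bounded (test_topology X) {\<phi> k}" for k
      using \<phi>X by (intro lc_bounded_singleton) (simp add: test_topology_eq)
    with \<phi> that show ?thesis
      using rescaling_of_bounded_sets[OF Xs(2,3)[of n] _ X, of "\<lambda>k. {\<phi> k}"] by blast
  qed
  define B where "B = (\<Union>k. cscale (complex_of_real (inverse (\<gamma> k))) ` {\<phi> k})"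
  have B: "B \<noteq> {}" "lc_bounded (test_topology X) B" using bd by (auto simp: B_def)
  have "continuous_seminorm (sheaf_topology G X) (dual_sup B)"
    by (rule continuous_seminorm_dual_sup[of G X, OF GX B])
  then obtain q where q: "continuous_seminorm (sheaf_topology G X) q"
    "\<forall>m\<ge>1. \<exists>\<Gamma>>0. \<forall>u\<in>G X. dual_sup B ((?C ^^ m) u) \<le> \<Gamma> * q u"
    using top unfolding topologizable_def topspace_sheaf_topology[of G X, OF GX(1)] by blast
  obtain B' C where B': "B' \<noteq> {}" "lc_bounded (test_topology X) B'" "0 < C"
    "\<And>u. u \<in> G X \<Longrightarrow> q u \<le> C * dual_sup B' u"
    using continuous_seminorm_sheaf_bound[of G X, OF GX q(1)] by metis
  obtain L where L: "compact L" "L \<subseteq> X" "B' \<subseteq> test_funs_in L"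
    using lc_bounded_common_support[OF X B'(2)] by blast
  obtain k where k: "L \<subseteq> Xs k" using exhaustion_compact[OF ex L(1,2)] by blast
  have Qk: "m k \<ge> 1" "0 < \<epsilon> k" "y k \<in> X - closure (Xs k)" "closure (ball (y k) (\<epsilon> k)) \<subseteq> X - Xs k"
    "h k \<in> G (ball (y k) (\<epsilon> k))" "\<theta> k \<in> test_funs (ball (y k) (\<epsilon> k))" "h k (\<theta> k) \<noteq> 0"
    "(Ct ^^ m k) (\<phi> k) = \<theta> k"
    using Q[of k] unfolding Q_def by blast+
  obtain \<Gamma> where \<Gamma>: "0 < \<Gamma>" "\<And>u. u \<in> G X \<Longrightarrow> dual_sup B ((?C ^^ m k) u) \<le> \<Gamma> * q u"
    using q(2) Qk(1) by blast
  have "cmod (u (\<theta> k)) \<le> (\<gamma> k * \<Gamma> * C) * dual_sup B' u" if u: "u \<in> G X" for u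
  proof -
    have uD: "u \<in> distributions X" using u GX by auto
    have BX: "B \<subseteq> test_funs X" using B(2) by (simp add: lc_bounded_def test_topology_eq)
    have \<theta>X: "\<theta> k \<in> test_funs X" using Ct_funpow_test_funs[OF \<phi>X] Qk(8) by metis
    let ?c = "complex_of_real (inverse (\<gamma> k))"
    have inB: "cscale ?c (\<phi> k) \<in> B" by (auto simp: B_def)
    have CuD: "(Ct ^^ m k) ` B \<noteq> {}" "lc_bounded (test_topology X) ((Ct ^^ m k) ` B)"
      using B Ct_funpow_lc_bounded by auto
    have "inverse (\<gamma> k) * cmod (u (\<theta> k)) = cmod (u (cscale ?c (\<theta> k)))"
      using distributions_cscale[OF uD \<theta>X] \<gamma>[of k] by (simp add: norm_mult norm_inverse)
    also have "cscale ?c (\<theta> k) = (Ct ^^ m k) (cscale ?c (\<phi> k))"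
      by (simp add: Ct_funpow_cscale Qk(8))
    also have "cmod (u \<dots>) \<le> dual_sup ((Ct ^^ m k) ` B) u"
      using inB by (intro dual_sup_upper[OF uD CuD(2)] imageI)
    also have "\<dots> = dual_sup B ((?C ^^ m k) u)"
      by (rule dual_sup_weighted_comp_funpow[OF uD BX, symmetric])
    also have "\<dots> \<le> \<Gamma> * q u" by (rule \<Gamma>(2)[OF u])
    also have "\<dots> \<le> \<Gamma> * (C * dual_sup B' u)" using B'(4)[OF u] \<Gamma>(1) by (intro mult_left_mono) auto
    finally show ?thesis using \<gamma>[of k] by (simp add: field_simps)
  qed
  moreover have "ball (y k) (\<epsilon> k) \<subseteq> closure (ball (y k) (\<epsilon> k))" by (rule closure_subset)
  then have "Xs k \<inter> ball (y k) (\<epsilon> k) = {}" "Xs k \<union> ball (y k) (\<epsilon> k) \<subseteq> X"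
    using Qk(4) Xs(4)[of k] by blast+
  moreover have "sheaf_topology G (Xs k \<union> ball (y k) (\<epsilon> k)) closure_of
      (restr (Xs k \<union> ball (y k) (\<epsilon> k)) ` G X) = G (Xs k \<union> ball (y k) (\<epsilon> k))"
    using a Qk(2-4) by blast
  ultimately show False
    using sheaf_separation[OF G X Xs(1) open_ball _ _ _ Qk(5,6,7) B'(1,2) L(1) k L(3)] by blast
qed

end

theorem theorem2p9:
  fixes X :: "(real^'n) set"
    and w :: "real^'n \<Rightarrow> complex"
    and \<psi> :: "real^'n \<Rightarrow> real^'n"
    and G :: "(real^'n) set \<Rightarrow> ((real^'n \<Rightarrow> complex) \<Rightarrow> complex) set"
  assumes X: "open X"
    and w: "smooth_on X w"
    and \<psi>: "smooth_on X \<psi>" "\<psi> ` X \<subseteq> X" "inj_on \<psi> X"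
      "\<forall>x\<in>X. det (jacobian \<psi> (at x)) \<noteq> 0"
    and G: "distribution_sheaf G"
    and invariant: "weighted_comp X w \<psi> ` G X \<subseteq> G X"
    and a: "\<exists>Xs. rel_compact_exhaustion X Xs \<and>
      (\<forall>n. \<forall>x \<in> X - closure (Xs n). \<forall>\<epsilon>>0. closure (ball x \<epsilon>) \<subseteq> X - Xs n \<longrightarrow>
         sheaf_topology G (Xs n \<union> ball x \<epsilon>) closure_of (restr (Xs n \<union> ball x \<epsilon>) ` G X)
           = G (Xs n \<union> ball x \<epsilon>))"
    and b: "\<exists>\<epsilon>\<^sub>0>0. \<forall>\<epsilon>. 0 < \<epsilon> \<and> \<epsilon> < \<epsilon>\<^sub>0 \<longrightarrow>
      (\<exists>\<eta> \<in> test_funs (ball 0 \<epsilon>). \<forall>x\<in>X. closure (ball x \<epsilon>) \<subseteq> X \<longrightarrow>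
         (\<exists>h \<in> G (ball x \<epsilon>). h (\<lambda>y. \<eta> (y - x)) \<noteq> 0))"
    and c: "\<forall>l::nat. X \<subseteq> closure {x \<in> X. w ((\<psi> ^^ l) x) \<noteq> 0}"
  shows "topologizable (sheaf_topology G X) (weighted_comp X w \<psi>) \<longleftrightarrow> stable_orbits X \<psi>"
proof -
  interpret weighted_map X w \<psi>
    using X w \<psi> by unfold_locales
  from a obtain Xs where Xs: "rel_compact_exhaustion X Xs"
    "\<forall>n. \<forall>x \<in> X - closure (Xs n). \<forall>\<epsilon>>0. closure (ball x \<epsilon>) \<subseteq> X - Xs n \<longrightarrow>
       sheaf_topology G (Xs n \<union> ball x \<epsilon>) closure_of (restr (Xs n \<union> ball x \<epsilon>) ` G X)
         = G (Xs n \<union> ball x \<epsilon>)" by blast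
  show ?thesis
    using stable_imp_topologizable[OF G invariant] topologizable_imp_stable[OF G Xs b c] by blast
qed

end
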